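(* Let $\Sigma\hookrightarrow\mathbb{H}^2\times\mathbb{R}$ be a (complete) properly immersed surface in $\mathbb{H}^2\times\mathbb{R}$. Let $\mathbb{B}\subset\mathbb{H}^2$ be a horoball. If $\Sigma$ is contained in the horocylinder $C=\overline{\mathbb{B}}\times\mathbb{R}$ with an interior point (that is, some point of $\Sigma$ lies in $\mathbb{B}\times\mathbb{R}$), then $\sup|\mathbf{H}|\ge\frac12$. In particular, if $\Sigma$ is contained in a horocylinder $C=\overline{\mathbb{B}}\times\mathbb{R}$ and $|\mathbf{H}|<\frac12$, then $\Sigma\subset\partial C=\partial\mathbb{B}\times\mathbb{R}$.
   Context: $\mathbb{H}^2$ is the hyperbolic plane of curvature $-1$; a horoball $\mathbb{B}$ is an open region bounded by a horocycle, and $\overline{\mathbb{B}}$ is its closure. $\mathbf{H}$ is the mean curvature vector of $\Sigma$, normalized as $\frac12$ times the trace of the second fundamental form, so that $\partial\mathbb{B}\times\mathbb{R}$ has $|\mathbf{H}|=\frac12$; the supremum is taken over $\Sigma$. *)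

theory Defs
  imports "HOL-Analysis.Analysis"
begin

section \<open>Smooth maps\<close>

text \<open>\<open>C_k_on k S f\<close> is meant for open \<open>S\<close>; derivatives are taken in the ambient space.\<close>

primrec C_k_on ::
  "nat \<Rightarrow> 'a::real_normed_vector set \<Rightarrow> ('a \<Rightarrow> 'b::real_normed_vector) \<Rightarrow> bool" where
  "C_k_on 0 S f \<longleftrightarrow> continuous_on S f"
| "C_k_on (Suc k) S f \<longleftrightarrow>
     (\<forall>x\<in>S. f differentiable (at x)) \<and>
     (\<forall>v. C_k_on k S (\<lambda>x. frechet_derivative f (at x) v))"

definition smooth_on ::
  "'a::real_normed_vector set \<Rightarrow> ('a \<Rightarrow> 'b::real_normed_vector) \<Rightarrow> bool" where
  "smooth_on S f \<longleftrightarrow> (\<forall>k. C_k_on k S f)"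


section \<open>The Riemannian manifold \<open>\<H>\<^sup>2 \<times> \<real>\<close>\<close>

text \<open>
  The upper half-plane model: a point of the product is a pair \<open>(z, t)\<close> with \<open>Im z > 0\<close>,
  the metric is \<open>(dx\<^sup>2 + dy\<^sup>2) / y\<^sup>2 + dt\<^sup>2\<close> where \<open>z = x + i y\<close>, and all tangent spaces
  are identified with \<open>\<complex> \<times> \<real>\<close>.
\<close>

definition H2 :: "complex set" where
  "H2 = {z. Im z > 0}"

definition H2xR :: "(complex \<times> real) set" where
  "H2xR = H2 \<times> UNIV"

definition metric :: "complex \<times> real \<Rightarrow> complex \<times> real \<Rightarrow> complex \<times> real \<Rightarrow> real" where
  "metric p v w = (fst v \<bullet> fst w) / (Im (fst p))\<^sup>2 + snd v * snd w"

text \<open>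
  The Christoffel symbols of the half-plane are
  \<open>\<Gamma>\<^sup>x\<^sub>x\<^sub>y = \<Gamma>\<^sup>x\<^sub>y\<^sub>x = \<Gamma>\<^sup>y\<^sub>y\<^sub>y = - 1 / y\<close> and \<open>\<Gamma>\<^sup>y\<^sub>x\<^sub>x = 1 / y\<close>, all others being zero;
  as a bilinear map, \<open>(v, w) \<mapsto> i v w / y\<close>. The factor \<open>\<real>\<close> is flat. The two lemmas below
  (torsion-freeness and compatibility with the metric) characterise the Levi-Civita connection.
\<close>

definition christoffel ::
  "complex \<times> real \<Rightarrow> complex \<times> real \<Rightarrow> complex \<times> real \<Rightarrow> complex \<times> real" where
  "christoffel p v w = (\<i> * fst v * fst w / complex_of_real (Im (fst p)), 0)"

lemma christoffel_commute: "christoffel p v w = christoffel p w v"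
  by (simp add: christoffel_def mult.commute mult.left_commute)

lemma christoffel_metric:
  assumes "p \<in> H2xR"
  shows "((\<lambda>q. metric q v w) has_derivative
           (\<lambda>u. metric p (christoffel p u v) w + metric p v (christoffel p u w))) (at p)"
proof -
  have y: "Im (fst p) > 0"
    using assms by (auto simp: H2xR_def H2_def)
  have "((\<lambda>q. (fst v \<bullet> fst w) / (Im (fst q))\<^sup>2 + snd v * snd w) has_derivative
          (\<lambda>u. - 2 * (fst v \<bullet> fst w) * Im (fst u) / Im (fst p) ^ 3)) (at p)"
    using y by (auto intro!: derivative_eq_intros simp: fun_eq_iff field_simps eval_nat_numeral)
  moreover have "metric p (christoffel p u v) w + metric p v (christoffel p u w) =
      - 2 * (fst v \<bullet> fst w) * Im (fst u) / Im (fst p) ^ 3" for u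
    using y by (simp add: metric_def christoffel_def inner_complex_def Re_divide Im_divide
        field_simps eval_nat_numeral)
  ultimately show ?thesis
    by (simp add: metric_def)
qed

text \<open>
  The horocycles of the half-plane model are the horizontal lines and the Euclidean circles
  tangent to the real axis (without the point of tangency). The horoballs are the regions on
  their convex sides.
\<close>

definition horoball :: "complex set \<Rightarrow> bool" where
  "horoball B \<longleftrightarrow>
     (\<exists>c>0. B = {z. Im z > c}) \<or> (\<exists>a r. r > 0 \<and> B = ball (Complex a r) r)"


section \<open>Mean curvature of a parametrised surface\<close>

text \<open>
  \<open>F\<close> is a local parametrisation of an immersed surface, defined near \<open>q\<close>, and \<open>i, j, k, l\<close>
  range over the two coordinate directions.
\<close>

definition partial :: "2 \<Rightarrow> (real^2 \<Rightarrow> 'b::real_normed_vector) \<Rightarrow> real^2 \<Rightarrow> 'b" where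
  "partial i F q = frechet_derivative F (at q) (axis i 1)"

definition first_form :: "(real^2 \<Rightarrow> complex \<times> real) \<Rightarrow> real^2 \<Rightarrow> real^2^2" where
  "first_form F q = (\<chi> i j. metric (F q) (partial i F q) (partial j F q))"

definition cov_deriv ::
  "(real^2 \<Rightarrow> complex \<times> real) \<Rightarrow> real^2 \<Rightarrow> 2 \<Rightarrow> 2 \<Rightarrow> complex \<times> real" where
  "cov_deriv F q i j =
     partial i (partial j F) q + christoffel (F q) (partial i F q) (partial j F q)"

definition normal_part ::
  "(real^2 \<Rightarrow> complex \<times> real) \<Rightarrow> real^2 \<Rightarrow> complex \<times> real \<Rightarrow> complex \<times> real" where
  "normal_part F q w =
     w - (\<Sum>k\<in>UNIV. \<Sum>l\<in>UNIV.
            (matrix_inv (first_form F q) $ k $ l * metric (F q) w (partial k F q))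
              *\<^sub>R partial l F q)"

definition second_form ::
  "(real^2 \<Rightarrow> complex \<times> real) \<Rightarrow> real^2 \<Rightarrow> 2 \<Rightarrow> 2 \<Rightarrow> complex \<times> real" where
  "second_form F q i j = normal_part F q (cov_deriv F q i j)"

definition mean_curv_param ::
  "(real^2 \<Rightarrow> complex \<times> real) \<Rightarrow> real^2 \<Rightarrow> complex \<times> real" where
  "mean_curv_param F q =
     (1/2) *\<^sub>R (\<Sum>i\<in>UNIV. \<Sum>j\<in>UNIV.
                (matrix_inv (first_form F q) $ i $ j) *\<^sub>R second_form F q i j)"


section \<open>Properly immersed surfaces\<close>

type_synonym 'a chart = "'a set \<times> ('a \<Rightarrow> real^2)"

definition chart_image :: "'a chart \<Rightarrow> (real^2) set" where
  "chart_image c = snd c ` fst c"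

definition chart_inv :: "'a chart \<Rightarrow> real^2 \<Rightarrow> 'a" where
  "chart_inv c = inv_into (fst c) (snd c)"

definition is_chart :: "'a topology \<Rightarrow> 'a chart \<Rightarrow> bool" where
  "is_chart M c \<longleftrightarrow>
     openin M (fst c) \<and> open (chart_image c) \<and>
     homeomorphic_map (subtopology M (fst c)) (top_of_set (chart_image c)) (snd c)"

definition smooth_surface :: "'a topology \<Rightarrow> 'a chart set \<Rightarrow> bool" where
  "smooth_surface M \<A> \<longleftrightarrow>
     Hausdorff_space M \<and> second_countable M \<and>
     (\<forall>c\<in>\<A>. is_chart M c) \<and> (\<Union>c\<in>\<A>. fst c) = topspace M \<and>
     (\<forall>c\<in>\<A>. \<forall>d\<in>\<A>. smooth_on (snd c ` (fst c \<inter> fst d)) (snd d \<circ> chart_inv c))"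

definition immersion :: "'a topology \<Rightarrow> 'a chart set \<Rightarrow> ('a \<Rightarrow> complex \<times> real) \<Rightarrow> bool" where
  "immersion M \<A> X \<longleftrightarrow>
     X ` topspace M \<subseteq> H2xR \<and>
     (\<forall>c\<in>\<A>. smooth_on (chart_image c) (X \<circ> chart_inv c) \<and>
       (\<forall>q\<in>chart_image c. inj (frechet_derivative (X \<circ> chart_inv c) (at q))))"

definition properly_immersed_surface ::
  "'a topology \<Rightarrow> 'a chart set \<Rightarrow> ('a \<Rightarrow> complex \<times> real) \<Rightarrow> bool" where
  "properly_immersed_surface M \<A> X \<longleftrightarrow>
     smooth_surface M \<A> \<and> immersion M \<A> X \<and> proper_map M (top_of_set H2xR) X"

text \<open>
  The mean curvature vector does not depend on the parametrisation, so it may be computed in an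
  arbitrary chart around the point.
\<close>

definition mean_curv ::
  "'a chart set \<Rightarrow> ('a \<Rightarrow> complex \<times> real) \<Rightarrow> 'a \<Rightarrow> complex \<times> real" where
  "mean_curv \<A> X p =
     (let c = (SOME c. c \<in> \<A> \<and> p \<in> fst c) in mean_curv_param (X \<circ> chart_inv c) (snd c p))"

definition mean_curv_norm ::
  "'a chart set \<Rightarrow> ('a \<Rightarrow> complex \<times> real) \<Rightarrow> 'a \<Rightarrow> real" where
  "mean_curv_norm \<A> X p =
     sqrt (metric (X p) (mean_curv \<A> X p) (mean_curv \<A> X p))"

end

theory Submission
  imports Defs
begin

text \<open>
  A nonempty properly immersed surface in a horocylinder \<open>C\<close> has a point with \<open>|\<^bold>H| \<ge> 1/2\<close>
  (\<open>no_surface_in_horocylinder\<close>). Both claims follow from this. For the first, a supremum below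
  \<open>1/2\<close> would leave no such point; for the second, the surface has to be empty. The second
  claim needs the pointwise form, since \<open>|\<^bold>H| < 1/2\<close> everywhere leaves room for a supremum of \<open>1/2\<close>.

  An isometry turns \<open>C\<close> into \<open>y \<ge> c\<close>. The horocylinders \<open>y = const\<close> have mean curvature \<open>1/2\<close>, with the
  mean curvature vector pointing upwards, so a surface with \<open>|\<^bold>H| < 1/2\<close> cannot touch one of them
  from above (\<open>no_lowest_point\<close>). In general the infimum of \<open>y\<close> on the surface is not attained, and
  the horocylinders have to be bent so that a first contact takes place at a finite point. As for
  the half-space theorem for minimal surfaces, the possibility of doing this is a matter of
  parabolicity: the horocylinder is a flat plane, its Jacobi operator is the Euclidean Laplacian,
  and the bending has to grow slowly and to leave out a compact core.

  The bent horocylinders are the level sets of \<open>- ln y - \<epsilon> ln (ln s)\<close>, where \<open>s = (x / y)\<^sup>2 + t\<^sup>2\<close> is the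
  squared distance to the origin in the flat coordinates of the horocylinder. For \<open>s \<ge> e\<close> and small
  \<open>\<epsilon>\<close> their mean curvature is at least \<open>1/2\<close> (\<open>barrier_inequality\<close>): minus the Laplacian of
  \<open>\<epsilon> ln (ln s)\<close> is its squared gradient divided by \<open>\<epsilon>\<close>, and this dominates the nonlinear errors,
  which are quadratic in the gradient. In the core \<open>s \<le> e\<close> the surface is separated from its infimal
  height by compactness, so that the first contact lies outside the core
  (\<open>no_surface_above_horocycle\<close>).

  Contact is analysed along two curves in the surface with orthonormal velocities, since the
  normal parts of their covariant accelerations add up to \<open>2\<^bold>H\<close>. Hence only ordinary second
  derivatives along curves are needed, for the barrier and for the isometry alike.
\<close>

section \<open>Second-order jets of curves\<close>

text \<open>
  \<open>v\<close> and \<open>a\<close> are the first and second derivative of \<open>\<gamma>\<close> at \<open>0\<close>, in the flat sense. The first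
  derivative has to exist on a neighbourhood, the second only at \<open>0\<close>; this is all that the
  second derivative test needs, and it is stable under sums, products and composition, so that
  the derivatives of explicit functions along unspecified curves can be assembled from parts.
\<close>

definition jet2 :: "(real \<Rightarrow> 'b::real_normed_vector) \<Rightarrow> 'b \<Rightarrow> 'b \<Rightarrow> bool" where
  "jet2 \<gamma> v a \<longleftrightarrow>
     (\<exists>\<gamma>'. (\<forall>\<^sub>F \<tau> in nhds 0. (\<gamma> has_vector_derivative \<gamma>' \<tau>) (at \<tau>)) \<and>
       \<gamma>' 0 = v \<and> (\<gamma>' has_vector_derivative a) (at 0))"

lemma jet2_imp_continuous:
  assumes "jet2 \<gamma> v a"
  shows "isCont \<gamma> 0"
proof -
  obtain \<gamma>' where "\<forall>\<^sub>F \<tau> in nhds 0. (\<gamma> has_vector_derivative \<gamma>' \<tau>) (at \<tau>)"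
    using assms unfolding jet2_def by blast
  then have "(\<gamma> has_vector_derivative \<gamma>' 0) (at 0)"
    by (rule eventually_nhds_x_imp_x)
  then show ?thesis
    by (rule has_vector_derivative_continuous)
qed

lemma jet2_linear:
  assumes "jet2 \<gamma> v a" "bounded_linear L"
  shows "jet2 (\<lambda>\<tau>. L (\<gamma> \<tau>)) (L v) (L a)"
proof -
  obtain \<gamma>' where g: "\<forall>\<^sub>F \<tau> in nhds 0. (\<gamma> has_vector_derivative \<gamma>' \<tau>) (at \<tau>)"
    "\<gamma>' 0 = v" "(\<gamma>' has_vector_derivative a) (at 0)"
    using assms(1) unfolding jet2_def by blast
  have "\<forall>\<^sub>F \<tau> in nhds 0. ((\<lambda>\<tau>. L (\<gamma> \<tau>)) has_vector_derivative L (\<gamma>' \<tau>)) (at \<tau>)"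
    using g(1) by eventually_elim (rule bounded_linear.has_vector_derivative[OF assms(2)])
  moreover have "((\<lambda>\<tau>. L (\<gamma>' \<tau>)) has_vector_derivative L a) (at 0)"
    by (rule bounded_linear.has_vector_derivative[OF assms(2) g(3)])
  ultimately show ?thesis
    unfolding jet2_def using g(2) by (intro exI[of _ "\<lambda>\<tau>. L (\<gamma>' \<tau>)"]) auto
qed

lemma jet2_add:
  assumes "jet2 \<gamma> v a" "jet2 \<delta> w b"
  shows "jet2 (\<lambda>\<tau>. \<gamma> \<tau> + \<delta> \<tau>) (v + w) (a + b)"
proof -
  obtain \<gamma>' where g: "\<forall>\<^sub>F \<tau> in nhds 0. (\<gamma> has_vector_derivative \<gamma>' \<tau>) (at \<tau>)"
    "\<gamma>' 0 = v" "(\<gamma>' has_vector_derivative a) (at 0)"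
    using assms(1) unfolding jet2_def by blast
  obtain \<delta>' where d: "\<forall>\<^sub>F \<tau> in nhds 0. (\<delta> has_vector_derivative \<delta>' \<tau>) (at \<tau>)"
    "\<delta>' 0 = w" "(\<delta>' has_vector_derivative b) (at 0)"
    using assms(2) unfolding jet2_def by blast
  have "\<forall>\<^sub>F \<tau> in nhds 0. ((\<lambda>\<tau>. \<gamma> \<tau> + \<delta> \<tau>) has_vector_derivative \<gamma>' \<tau> + \<delta>' \<tau>) (at \<tau>)"
    using g(1) d(1) by eventually_elim (rule has_vector_derivative_add)
  moreover have "((\<lambda>\<tau>. \<gamma>' \<tau> + \<delta>' \<tau>) has_vector_derivative a + b) (at 0)"
    by (rule has_vector_derivative_add[OF g(3) d(3)])
  ultimately show ?thesis
    unfolding jet2_def using g(2) d(2) by (intro exI[of _ "\<lambda>\<tau>. \<gamma>' \<tau> + \<delta>' \<tau>"]) auto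
qed

lemma jet2_mult:
  fixes \<gamma> \<delta> :: "real \<Rightarrow> 'b::{real_normed_field}"
  assumes "jet2 \<gamma> v a" "jet2 \<delta> w b"
  shows "jet2 (\<lambda>\<tau>. \<gamma> \<tau> * \<delta> \<tau>) (v * \<delta> 0 + \<gamma> 0 * w) (a * \<delta> 0 + 2 * v * w + \<gamma> 0 * b)"
proof -
  obtain \<gamma>' where g: "\<forall>\<^sub>F \<tau> in nhds 0. (\<gamma> has_vector_derivative \<gamma>' \<tau>) (at \<tau>)"
    "\<gamma>' 0 = v" "(\<gamma>' has_vector_derivative a) (at 0)"
    using assms(1) unfolding jet2_def by blast
  obtain \<delta>' where d: "\<forall>\<^sub>F \<tau> in nhds 0. (\<delta> has_vector_derivative \<delta>' \<tau>) (at \<tau>)"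
    "\<delta>' 0 = w" "(\<delta>' has_vector_derivative b) (at 0)"
    using assms(2) unfolding jet2_def by blast
  have g0: "(\<gamma> has_vector_derivative v) (at 0)" and d0: "(\<delta> has_vector_derivative w) (at 0)"
    using g(1,2) d(1,2) eventually_nhds_x_imp_x by blast+
  have "\<forall>\<^sub>F \<tau> in nhds 0. ((\<lambda>\<tau>. \<gamma> \<tau> * \<delta> \<tau>) has_vector_derivative
      \<gamma> \<tau> * \<delta>' \<tau> + \<gamma>' \<tau> * \<delta> \<tau>) (at \<tau>)"
    using g(1) d(1) by eventually_elim (rule has_vector_derivative_mult)
  moreover have "((\<lambda>\<tau>. \<gamma> \<tau> * \<delta>' \<tau> + \<gamma>' \<tau> * \<delta> \<tau>) has_vector_derivative
      (\<gamma> 0 * b + v * \<delta>' 0) + (\<gamma>' 0 * w + a * \<delta> 0)) (at 0)"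
    by (intro has_vector_derivative_add has_vector_derivative_mult g0 d0 g(3) d(3))
  ultimately show ?thesis
    unfolding jet2_def using g(2) d(2)
    by (intro exI[of _ "\<lambda>\<tau>. \<gamma> \<tau> * \<delta>' \<tau> + \<gamma>' \<tau> * \<delta> \<tau>"]) (auto simp: algebra_simps)
qed

lemma jet2_compose_field:
  fixes \<gamma> :: "real \<Rightarrow> 'b::real_normed_field"
  assumes j: "jet2 \<gamma> v a"
    and f: "\<forall>\<^sub>F z in nhds (\<gamma> 0). (f has_field_derivative f' z) (at z)"
    and f': "(f' has_field_derivative f'') (at (\<gamma> 0))"
  shows "jet2 (\<lambda>\<tau>. f (\<gamma> \<tau>)) (f' (\<gamma> 0) * v) (f'' * v\<^sup>2 + f' (\<gamma> 0) * a)"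
proof -
  obtain \<gamma>' where g: "\<forall>\<^sub>F \<tau> in nhds 0. (\<gamma> has_vector_derivative \<gamma>' \<tau>) (at \<tau>)"
    "\<gamma>' 0 = v" "(\<gamma>' has_vector_derivative a) (at 0)"
    using j unfolding jet2_def by blast
  have g0: "(\<gamma> has_vector_derivative v) (at 0)"
    using g(1,2) eventually_nhds_x_imp_x by blast
  have "\<forall>\<^sub>F \<tau> in nhds 0. (f has_field_derivative f' (\<gamma> \<tau>)) (at (\<gamma> \<tau>))"
    using f jet2_imp_continuous[OF j]
    by (intro eventually_compose_filterlim[OF f]) (simp add: isCont_def tendsto_at_iff_tendsto_nhds)
  then have "\<forall>\<^sub>F \<tau> in nhds 0. ((\<lambda>\<tau>. f (\<gamma> \<tau>)) has_vector_derivative \<gamma>' \<tau> * f' (\<gamma> \<tau>)) (at \<tau>)"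
    using g(1)
  proof eventually_elim
    case (elim \<tau>)
    then show ?case using field_vector_diff_chain_at[OF elim(2,1)] by (simp add: o_def)
  qed
  moreover have "((\<lambda>\<tau>. \<gamma>' \<tau> * f' (\<gamma> \<tau>)) has_vector_derivative
      \<gamma>' 0 * (v * f'') + a * f' (\<gamma> 0)) (at 0)"
    using field_vector_diff_chain_at[OF g0 f']
    by (intro has_vector_derivative_mult g(3)) (simp add: o_def)
  ultimately show ?thesis
    unfolding jet2_def using g(2)
    by (intro exI[of _ "\<lambda>\<tau>. \<gamma>' \<tau> * f' (\<gamma> \<tau>)"]) (auto simp: algebra_simps power2_eq_square)
qed

lemma jet2_inverse:
  fixes \<gamma> :: "real \<Rightarrow> 'b::real_normed_field"
  assumes "jet2 \<gamma> v a" "\<gamma> 0 \<noteq> 0"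
  shows "jet2 (\<lambda>\<tau>. inverse (\<gamma> \<tau>)) (- v / (\<gamma> 0)\<^sup>2) (2 * v\<^sup>2 / \<gamma> 0 ^ 3 - a / (\<gamma> 0)\<^sup>2)"
proof -
  have "\<forall>\<^sub>F z in nhds (\<gamma> 0). (inverse has_field_derivative - (1 / z\<^sup>2)) (at z)"
  proof -
    have "\<forall>\<^sub>F z in nhds (\<gamma> 0). z \<noteq> 0"
      using assms(2) by (simp add: t1_space_nhds)
    then show ?thesis
      by eventually_elim (auto intro!: derivative_eq_intros simp: power2_eq_square field_simps)
  qed
  moreover have "((\<lambda>z. - (1 / z\<^sup>2)) has_field_derivative 2 / \<gamma> 0 ^ 3) (at (\<gamma> 0))"
    using assms(2) by (auto intro!: derivative_eq_intros simp: field_simps eval_nat_numeral)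
  ultimately show ?thesis
    using jet2_compose_field[OF assms(1), of inverse "\<lambda>z. - (1 / z\<^sup>2)" "2 / \<gamma> 0 ^ 3"] by simp
qed

lemma jet2_ln:
  fixes \<gamma> :: "real \<Rightarrow> real"
  assumes "jet2 \<gamma> v a" "\<gamma> 0 > 0"
  shows "jet2 (\<lambda>\<tau>. ln (\<gamma> \<tau>)) (v / \<gamma> 0) (a / \<gamma> 0 - (v / \<gamma> 0)\<^sup>2)"
proof -
  have "\<forall>\<^sub>F z in nhds (\<gamma> 0). (ln has_field_derivative inverse z) (at z)"
  proof -
    have "\<forall>\<^sub>F z in nhds (\<gamma> 0). z > 0"
      using eventually_nhds_in_open[of "{0<..}" "\<gamma> 0"] assms(2) by simp
    then show ?thesis
      by eventually_elim (auto intro!: derivative_eq_intros simp: field_simps)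
  qed
  moreover have "(inverse has_field_derivative - (inverse (\<gamma> 0))\<^sup>2) (at (\<gamma> 0))"
    using assms(2) by (auto intro!: derivative_eq_intros simp: power2_eq_square)
  ultimately show ?thesis
    using jet2_compose_field[OF assms(1), of ln inverse "- (inverse (\<gamma> 0))\<^sup>2"]
    by (simp add: divide_inverse power_mult_distrib mult.commute)
qed

text \<open>
  If \<open>D\<close> were positive, \<open>f'\<close> would be positive just to the right of its zero at \<open>0\<close>, and \<open>f\<close>
  would increase there by the mean value theorem.
\<close>

lemma jet2_local_max:
  fixes f :: "real \<Rightarrow> real"
  assumes j: "jet2 f d D" and m: "\<forall>\<^sub>F \<tau> in nhds 0. f \<tau> \<le> f 0"
  shows "d = 0" "D \<le> 0"
proof -
  obtain f' where g: "\<forall>\<^sub>F \<tau> in nhds 0. (f has_vector_derivative f' \<tau>) (at \<tau>)"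
    "f' 0 = d" "(f' has_vector_derivative D) (at 0)"
    using j unfolding jet2_def by blast
  obtain e where e: "e > 0" "\<And>\<tau>. \<bar>\<tau>\<bar> < e \<Longrightarrow> f \<tau> \<le> f 0"
    "\<And>\<tau>. \<bar>\<tau>\<bar> < e \<Longrightarrow> (f has_real_derivative f' \<tau>) (at \<tau>)"
    using eventually_conj[OF g(1) m] unfolding eventually_nhds_metric
    by (auto simp: dist_real_def has_real_derivative_iff_has_vector_derivative)
  have d0: "f' 0 = 0"
    using DERIV_local_max[of f "f' 0" 0 e] e by auto
  then show "d = 0" using g(2) by simp
  show "D \<le> 0"
  proof (rule ccontr)
    assume "\<not> D \<le> 0"
    then obtain s where s: "s > 0" "\<And>h. 0 < h \<Longrightarrow> h < s \<Longrightarrow> f' 0 < f' (0 + h)"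
      using DERIV_pos_inc_right[of f' D 0] g(3)
      by (auto simp: has_real_derivative_iff_has_vector_derivative)
    define h where "h = min e s / 2"
    have h: "0 < h" "h < e" "h < s" using e s by (auto simp: h_def)
    obtain z where z: "0 < z" "z < h" "f h - f 0 = (h - 0) * f' z"
      using MVT2[of 0 h f f'] h e by force
    have "f' z > 0" using s(2)[of z] z h d0 by auto
    then show False using z h e(2)[of h] by (smt (verit) mult_pos_pos)
  qed
qed

text \<open>
  The rows of a \<open>3 \<times> 3\<close> matrix are orthonormal, hence so are its columns. With the unit normal as
  third row, this expresses the trace over a tangent plane by the normal vector alone.
\<close>

lemma orthonormal_columns:
  fixes x1 y1 z1 x2 y2 z2 x3 y3 z3 :: real
  assumes "x1 * x1 + y1 * y1 + z1 * z1 = 1" "x2 * x2 + y2 * y2 + z2 * z2 = 1"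
    "x3 * x3 + y3 * y3 + z3 * z3 = 1" "x1 * x2 + y1 * y2 + z1 * z2 = 0"
    "x3 * x1 + y3 * y1 + z3 * z1 = 0" "x3 * x2 + y3 * y2 + z3 * z2 = 0"
  shows "x1 * x1 + x2 * x2 + x3 * x3 = 1" "y1 * y1 + y2 * y2 + y3 * y3 = 1"
    "z1 * z1 + z2 * z2 + z3 * z3 = 1" "x1 * y1 + x2 * y2 + x3 * y3 = 0"
proof -
  define A :: "real^3^3" where
    "A = vector [vector [x1, y1, z1], vector [x2, y2, z2], vector [x3, y3, z3]]"
  have "A ** transpose A = mat 1"
    using assms by (simp add: A_def vec_eq_iff forall_3 matrix_matrix_mult_def transpose_def mat_def
        sum_3 vector_3 mult.commute)
  then have "transpose A ** A = mat 1"
    using matrix_left_right_inverse by blast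
  then show "x1 * x1 + x2 * x2 + x3 * x3 = 1" "y1 * y1 + y2 * y2 + y3 * y3 = 1"
    "z1 * z1 + z2 * z2 + z3 * z3 = 1" "x1 * y1 + x2 * y2 + x3 * y3 = 0"
    by (simp_all add: A_def vec_eq_iff forall_3 matrix_matrix_mult_def transpose_def mat_def
        sum_3 vector_3)
qed

section \<open>The maximum principle along two curves\<close>

text \<open>
  The bound \<open>|\<^bold>H| < 1/2\<close> at \<open>p\<close> for a surface piece inside \<open>S\<close>, phrased without a parametrisation.
  If \<open>\<gamma>1\<close> and \<open>\<gamma>2\<close> have orthonormal velocities at \<open>p\<close>, the normal part of the sum of their
  covariant accelerations is the trace of the second fundamental form, that is \<open>2\<^bold>H\<close>; so the sum
  has product less than \<open>|N|\<close> with every nonzero normal vector \<open>N\<close>. Only two curves have to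
  be carried along by an isometry, and only two functions of one variable occur in the
  maximum principle.
\<close>

definition mean_curv_below_half :: "(complex \<times> real) set \<Rightarrow> complex \<times> real \<Rightarrow> bool" where
  "mean_curv_below_half S p \<longleftrightarrow>
     (\<exists>\<gamma>1 v1 a1 \<gamma>2 v2 a2.
       jet2 \<gamma>1 v1 a1 \<and> jet2 \<gamma>2 v2 a2 \<and> \<gamma>1 0 = p \<and> \<gamma>2 0 = p \<and>
       (\<forall>\<^sub>F \<tau> in nhds 0. \<gamma>1 \<tau> \<in> S) \<and> (\<forall>\<^sub>F \<tau> in nhds 0. \<gamma>2 \<tau> \<in> S) \<and>
       metric p v1 v1 = 1 \<and> metric p v2 v2 = 1 \<and> metric p v1 v2 = 0 \<and>
       (\<forall>N. metric p N v1 = 0 \<longrightarrow> metric p N v2 = 0 \<longrightarrow> N \<noteq> 0 \<longrightarrow>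
         \<bar>metric p N (a1 + christoffel p v1 v1) + metric p N (a2 + christoffel p v2 v2)\<bar>
           < sqrt (metric p N N)))"

text \<open>
  The maximum principle. The premise \<open>jet\<close> says that \<open>N\<close> is the gradient and \<open>Q\<close> the Hessian
  quadratic form of \<open>u\<close> at \<open>p\<close>, both with respect to the product metric: the second derivative
  along a curve is \<open>\<langle>N, a + \<Gamma>(v,v)\<rangle> + Q v\<close>. At a maximum of \<open>u\<close> on \<open>S\<close> the first derivatives vanish, so
  \<open>N\<close> is normal, and the two second derivatives are at most \<open>0\<close>. Their sum is the trace of \<open>Q\<close> on
  the tangent plane plus a product which exceeds \<open>-|N|\<close> by the curvature bound.
\<close>

lemma touching_from_above:
  fixes u :: "complex \<times> real \<Rightarrow> real"
  assumes S: "mean_curv_below_half S p"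
    and max: "\<forall>\<^sub>F p' in nhds p. p' \<in> S \<longrightarrow> u p' \<le> u p"
    and N: "N \<noteq> 0"
    and jet: "\<And>\<gamma> v a. jet2 \<gamma> v a \<Longrightarrow> \<gamma> 0 = p \<Longrightarrow>
      jet2 (\<lambda>\<tau>. u (\<gamma> \<tau>)) (metric p N v) (metric p N (a + christoffel p v v) + Q v)"
  obtains v1 v2 where "metric p v1 v1 = 1" "metric p v2 v2 = 1" "metric p v1 v2 = 0"
    "metric p N v1 = 0" "metric p N v2 = 0" "Q v1 + Q v2 < sqrt (metric p N N)"
proof -
  obtain \<gamma>1 v1 a1 \<gamma>2 v2 a2 where g:
    "jet2 \<gamma>1 v1 a1" "jet2 \<gamma>2 v2 a2" "\<gamma>1 0 = p" "\<gamma>2 0 = p"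
    "\<forall>\<^sub>F \<tau> in nhds 0. \<gamma>1 \<tau> \<in> S" "\<forall>\<^sub>F \<tau> in nhds 0. \<gamma>2 \<tau> \<in> S"
    "metric p v1 v1 = 1" "metric p v2 v2 = 1" "metric p v1 v2 = 0"
    and H: "\<And>N. metric p N v1 = 0 \<Longrightarrow> metric p N v2 = 0 \<Longrightarrow> N \<noteq> 0 \<Longrightarrow>
         \<bar>metric p N (a1 + christoffel p v1 v1) + metric p N (a2 + christoffel p v2 v2)\<bar>
           < sqrt (metric p N N)"
    using S unfolding mean_curv_below_half_def by blast
  have crit: "metric p N v = 0 \<and> metric p N (a + christoffel p v v) + Q v \<le> 0"
    if j: "jet2 \<gamma> v a" and p: "\<gamma> 0 = p" and i: "\<forall>\<^sub>F \<tau> in nhds 0. \<gamma> \<tau> \<in> S" for \<gamma> v a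
  proof -
    have "filterlim \<gamma> (nhds p) (nhds 0)"
      using jet2_imp_continuous[OF j] p tendsto_at_iff_tendsto_nhds[of \<gamma> 0]
      by (simp add: isCont_def)
    from eventually_compose_filterlim[OF max this] i
    have "\<forall>\<^sub>F \<tau> in nhds 0. u (\<gamma> \<tau>) \<le> u (\<gamma> 0)"
      by eventually_elim (simp add: p)
    from jet2_local_max[OF jet[OF j p] this] show ?thesis by simp
  qed
  have c: "metric p N v1 = 0" "metric p N v2 = 0"
    "metric p N (a1 + christoffel p v1 v1) + Q v1 \<le> 0"
    "metric p N (a2 + christoffel p v2 v2) + Q v2 \<le> 0"
    using crit[OF g(1,3,5)] crit[OF g(2,4,6)] by auto
  have "Q v1 + Q v2 < sqrt (metric p N N)"
    using H[OF c(1,2) N] c(3,4) by linarith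
  with that g c show thesis by blast
qed

text \<open>
  The metric in the components with respect to the orthonormal frame \<open>y\<partial>\<^sub>x, y\<partial>\<^sub>y, \<partial>\<^sub>t\<close>.
\<close>

lemma metric_frame:
  "metric p v w = Re (fst v) / Im (fst p) * (Re (fst w) / Im (fst p))
     + Im (fst v) / Im (fst p) * (Im (fst w) / Im (fst p)) + snd v * snd w"
  by (simp add: metric_def inner_complex_def add_divide_distrib power2_eq_square)

lemma christoffel_same:
  "fst (christoffel p v v) = Complex (- 2 * Re (fst v) * Im (fst v) / Im (fst p))
     (((Re (fst v))\<^sup>2 - (Im (fst v))\<^sup>2) / Im (fst p))"
  "snd (christoffel p v v) = 0"
  by (auto simp: christoffel_def complex_eq_iff Re_divide_of_real Im_divide_of_real
      power2_eq_square)

lemma jet2_coordinates: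
  assumes "jet2 \<gamma> v a"
  shows "jet2 (\<lambda>\<tau>. Re (fst (\<gamma> \<tau>))) (Re (fst v)) (Re (fst a))"
    "jet2 (\<lambda>\<tau>. Im (fst (\<gamma> \<tau>))) (Im (fst v)) (Im (fst a))"
    "jet2 (\<lambda>\<tau>. snd (\<gamma> \<tau>)) (snd v) (snd a)"
  using jet2_linear[OF assms bounded_linear_compose[OF bounded_linear_Re bounded_linear_fst]]
    jet2_linear[OF assms bounded_linear_compose[OF bounded_linear_Im bounded_linear_fst]]
    jet2_linear[OF assms bounded_linear_snd] by simp_all

text \<open>
  A lowest point would be a point of contact with the horocylinder of that height from its convex
  side, and the horocylinder has \<open>|\<^bold>H| = 1/2\<close>. The function to maximise is \<open>- ln y\<close>, whose gradient
  has length \<open>1\<close> and whose Hessian is \<open>X\<^sup>2\<close>, with trace \<open>1\<close> on the tangent plane of the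
  horocylinder.
\<close>

lemma no_lowest_point:
  assumes S: "mean_curv_below_half S p" and y: "Im (fst p) > 0"
    and min: "\<forall>\<^sub>F p' in nhds p. p' \<in> S \<longrightarrow> Im (fst p) \<le> Im (fst p')"
  shows False
proof -
  define y where "y = Im (fst p)"
  have y0: "y > 0" using y by (simp add: y_def)
  define N :: "complex \<times> real" where "N = (Complex 0 (- y), 0)"
  define Q where "Q = (\<lambda>v::complex \<times> real. (Re (fst v) / y)\<^sup>2)"
  have N0: "N \<noteq> 0" using y0 by (simp add: N_def complex_eq_iff prod_eq_iff)
  have max: "\<forall>\<^sub>F p' in nhds p. p' \<in> S \<longrightarrow> - ln (Im (fst p')) \<le> - ln (Im (fst p))"
    using min by eventually_elim (use y in auto)
  have jet: "jet2 (\<lambda>\<tau>. - ln (Im (fst (\<gamma> \<tau>)))) (metric p N v)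
      (metric p N (a + christoffel p v v) + Q v)"
    if j: "jet2 \<gamma> v a" "\<gamma> 0 = p" for \<gamma> v a
  proof -
    have "jet2 (\<lambda>\<tau>. - ln (Im (fst (\<gamma> \<tau>)))) (- (Im (fst v) / y))
        (- (Im (fst a) / y - (Im (fst v) / y)\<^sup>2))"
      using jet2_linear[OF jet2_ln[OF jet2_coordinates(2)[OF j(1)]]
          bounded_linear_minus[OF bounded_linear_ident]] j(2) y0
      by (simp add: y_def)
    moreover have "metric p N v = - (Im (fst v) / y)"
      "metric p N (a + christoffel p v v) + Q v = - (Im (fst a) / y - (Im (fst v) / y)\<^sup>2)"
      using y0 by (simp_all add: metric_frame N_def Q_def christoffel_same flip: y_def)
        (simp add: field_simps power2_eq_square)
    ultimately show ?thesis by simp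
  qed
  obtain v w where vw: "metric p v v = 1" "metric p w w = 1" "metric p v w = 0"
    "metric p N v = 0" "metric p N w = 0" "Q v + Q w < sqrt (metric p N N)"
    by (rule touching_from_above[OF S max N0 jet])
  have "metric p N N = 1" using y0 by (simp add: metric_frame N_def flip: y_def)
  moreover have "Q v + Q w = 1"
    using orthonormal_columns(1)[of "Re (fst v) / y" "Im (fst v) / y" "snd v"
        "Re (fst w) / y" "Im (fst w) / y" "snd w" 0 "-1" 0] vw(1-5) y0
    by (simp add: metric_frame N_def Q_def power2_eq_square flip: y_def)
  ultimately show False using vw(6) by simp
qed

section \<open>The doubly logarithmic barrier\<close>

text \<open>
  The level sets of the barrier \<open>- ln y - \<epsilon> ln (ln s)\<close>, with \<open>\<xi> = x / y\<close> and \<open>s = \<xi>\<^sup>2 + t\<^sup>2\<close>, have mean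
  curvature at least \<open>1/2\<close>. In the orthonormal frame \<open>y\<partial>\<^sub>x, y\<partial>\<^sub>y, \<partial>\<^sub>t\<close> its gradient is \<open>(g1, g2, g3)\<close> and
  its Hessian quadratic form is \<open>Q\<close>; the claim is that the trace of \<open>Q\<close> on the plane orthogonal
  to the gradient is at least the length of the gradient.

  For \<open>\<epsilon> = 0\<close> both sides are \<open>1\<close>. The terms of first order in \<open>\<epsilon>\<close> cancel, because the horocylinder
  is flat and its Jacobi operator is the Euclidean Laplacian, except for \<open>-\<epsilon>\<close> times the Laplacian
  of \<open>ln (ln s)\<close> in the plane. That Laplacian is \<open>-4 / (s L\<^sup>2)\<close> with \<open>L = ln s\<close>,
  which makes this term equal to \<open>E / \<epsilon>\<close>, where \<open>E\<close> is the squared length of the gradient of \<open>\<epsilon> ln (ln s)\<close> in the \<open>(\<xi>, t)\<close> plane. All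
  remaining terms are bounded by fixed multiples of \<open>E\<close>, so a small \<open>\<epsilon>\<close> suffices. This balance
  between Laplacian and squared gradient is what singles out the double logarithm.
\<close>

lemma barrier_inequality:
  fixes \<xi> t \<epsilon> :: real
  defines "s \<equiv> \<xi>\<^sup>2 + t\<^sup>2"
  defines "L \<equiv> ln s"
  defines "k \<equiv> 1 / (s * L)"
  defines "\<kappa> \<equiv> 2 * \<epsilon> * k"
  defines "g1 \<equiv> - \<kappa> * \<xi>" and "g2 \<equiv> - 1 + \<kappa> * \<xi>\<^sup>2" and "g3 \<equiv> - \<kappa> * t"
  defines "Q \<equiv> \<lambda>X Y Z. X\<^sup>2 - \<epsilon> * (2 * k * ((X - \<xi> * Y)\<^sup>2 + Z\<^sup>2 + \<xi>\<^sup>2 * (X\<^sup>2 + Y\<^sup>2))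
    - (1 + 1 / L) / (s\<^sup>2 * L) * (2 * \<xi> * (X - \<xi> * Y) + 2 * t * Z)\<^sup>2)"
  assumes s: "s \<ge> exp 1" and \<epsilon>: "0 < \<epsilon>" "\<epsilon> \<le> 1 / 10"
    and on: "X1 * X1 + Y1 * Y1 + Z1 * Z1 = 1" "X2 * X2 + Y2 * Y2 + Z2 * Z2 = 1"
      "X1 * X2 + Y1 * Y2 + Z1 * Z2 = 0"
    and tan: "g1 * X1 + g2 * Y1 + g3 * Z1 = 0" "g1 * X2 + g2 * Y2 + g3 * Z2 = 0"
  shows "sqrt (g1\<^sup>2 + g2\<^sup>2 + g3\<^sup>2) \<le> Q X1 Y1 Z1 + Q X2 Y2 Z2"
proof -
  have e2: "exp 1 \<ge> (2::real)"
    using exp_ge_add_one_self[of 1] by simp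
  have s2: "s \<ge> 2" using s e2 by linarith
  have L1: "L \<ge> 1" using s s2 unfolding L_def by (simp add: ln_ge_iff)
  have sL: "s * L \<ge> 2" using s2 L1 mult_mono[of 2 s 1 L] by simp
  have k: "0 < k" "k \<le> 1/2" using sL by (auto simp: k_def field_simps)
  have ksL: "k * s * L = 1" using sL by (auto simp: k_def)
  have \<kappa>0: "0 < \<kappa>" "\<kappa> \<le> 1 / 10"
    using k \<epsilon> mult_mono[of \<epsilon> "1/10" k "1/2"] by (auto simp: \<kappa>_def)
  have \<kappa>s: "\<kappa> * s * L = 2 * \<epsilon>" using ksL by (simp add: \<kappa>_def)
  have \<kappa>s': "\<kappa> * s \<le> 2 * \<epsilon>"
    using \<kappa>s L1 \<kappa>0 s2 mult_left_mono[of 1 L "\<kappa> * s"] by simp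
  have \<kappa>\<xi>: "0 \<le> \<kappa> * \<xi>\<^sup>2" "\<kappa> * \<xi>\<^sup>2 \<le> 1 / 5"
  proof -
    show "0 \<le> \<kappa> * \<xi>\<^sup>2" using \<kappa>0 by simp
    have "\<kappa> * \<xi>\<^sup>2 \<le> \<kappa> * s" using \<kappa>0 by (intro mult_left_mono) (auto simp: s_def)
    then show "\<kappa> * \<xi>\<^sup>2 \<le> 1 / 5" using \<kappa>s' \<epsilon> by linarith
  qed
  define b where "b = 1 - \<kappa> * \<xi>\<^sup>2"
  define E where "E = \<kappa>\<^sup>2 * s"
  have b: "4/5 \<le> b" "b \<le> 1" using \<kappa>\<xi> by (auto simp: b_def)
  have E0: "0 \<le> E" using s2 by (simp add: E_def)
  have E1: "E \<le> 1"
  proof -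
    have "E = \<kappa> * (\<kappa> * s)" by (simp add: E_def power2_eq_square)
    also have "\<dots> \<le> 1 / 10 * (1 / 5)" using \<kappa>0 \<kappa>s' \<epsilon> s2 by (intro mult_mono) auto
    finally show ?thesis by simp
  qed
  have EL: "E * L = 2 * \<kappa> * \<epsilon>"
  proof -
    have "E * L = \<kappa> * (\<kappa> * s * L)" by (simp add: E_def power2_eq_square)
    then show ?thesis by (simp add: \<kappa>s)
  qed
  define W2 where "W2 = b\<^sup>2 + E"
  have g: "g1\<^sup>2 + g2\<^sup>2 + g3\<^sup>2 = W2"
    by (simp add: g1_def g2_def g3_def W2_def b_def E_def s_def power2_eq_square algebra_simps)
  have W2: "W2 > 0" using b E0 by (simp add: W2_def add_pos_nonneg)
  define W where "W = sqrt W2"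
  have W: "W > 0" "W\<^sup>2 = W2" using W2 by (auto simp: W_def)
  have WW: "W * W = W2" using W(2) by (simp add: power2_eq_square)
  note cols = orthonormal_columns[of X1 Y1 Z1 X2 Y2 Z2 "g1 / W" "g2 / W" "g3 / W"]
  have c: "X1 * X1 + X2 * X2 + g1 / W * (g1 / W) = 1"
    "Y1 * Y1 + Y2 * Y2 + g2 / W * (g2 / W) = 1"
    "Z1 * Z1 + Z2 * Z2 + g3 / W * (g3 / W) = 1"
    "X1 * Y1 + X2 * Y2 + g1 / W * (g2 / W) = 0"
  proof -
    have "g1 / W * (g1 / W) + g2 / W * (g2 / W) + g3 / W * (g3 / W) = (g1\<^sup>2 + g2\<^sup>2 + g3\<^sup>2) / (W * W)"
      by (simp add: add_divide_distrib power2_eq_square)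
    then have 3: "g1 / W * (g1 / W) + g2 / W * (g2 / W) + g3 / W * (g3 / W) = 1"
      using g WW W2 by simp
    have "g1 / W * X1 + g2 / W * Y1 + g3 / W * Z1 = (g1 * X1 + g2 * Y1 + g3 * Z1) / W"
      "g1 / W * X2 + g2 / W * Y2 + g3 / W * Z2 = (g1 * X2 + g2 * Y2 + g3 * Z2) / W"
      by (simp_all add: add_divide_distrib)
    then have "g1 / W * X1 + g2 / W * Y1 + g3 / W * Z1 = 0"
      "g1 / W * X2 + g2 / W * Y2 + g3 / W * Z2 = 0"
      using tan by simp_all
    from cols[OF on(1,2) 3 on(3) this] show
      "X1 * X1 + X2 * X2 + g1 / W * (g1 / W) = 1"
      "Y1 * Y1 + Y2 * Y2 + g2 / W * (g2 / W) = 1"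
      "Z1 * Z1 + Z2 * Z2 + g3 / W * (g3 / W) = 1"
      "X1 * Y1 + X2 * Y2 + g1 / W * (g2 / W) = 0" .
  qed
  \<comment> \<open>Division by \<open>W\<^sup>2\<close> is avoided from here on by multiplying traces by it.\<close>
  have gg: "x / W * (y / W) * W2 = x * y" for x y using WW W(1) W2 by (simp add: field_simps)
  have sums: "(X1\<^sup>2 + X2\<^sup>2) * W2 = W2 - \<kappa>\<^sup>2 * \<xi>\<^sup>2" "(Y1\<^sup>2 + Y2\<^sup>2) * W2 = E"
    "(Z1\<^sup>2 + Z2\<^sup>2) * W2 = W2 - \<kappa>\<^sup>2 * t\<^sup>2" "(X1 * Y1 + X2 * Y2) * W2 = - \<kappa> * \<xi> * b"
  proof -
    have "(X1\<^sup>2 + X2\<^sup>2) * W2 = W2 - g1 / W * (g1 / W) * W2"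
      "(Y1\<^sup>2 + Y2\<^sup>2) * W2 = W2 - g2 / W * (g2 / W) * W2"
      "(Z1\<^sup>2 + Z2\<^sup>2) * W2 = W2 - g3 / W * (g3 / W) * W2"
      "(X1 * Y1 + X2 * Y2) * W2 = - (g1 / W * (g2 / W) * W2)"
      using arg_cong[OF c(1), of "\<lambda>x. x * W2"] arg_cong[OF c(2), of "\<lambda>x. x * W2"]
        arg_cong[OF c(3), of "\<lambda>x. x * W2"] arg_cong[OF c(4), of "\<lambda>x. x * W2"]
      by (simp_all add: algebra_simps power2_eq_square)
    then show "(X1\<^sup>2 + X2\<^sup>2) * W2 = W2 - \<kappa>\<^sup>2 * \<xi>\<^sup>2" "(Y1\<^sup>2 + Y2\<^sup>2) * W2 = E"
      "(Z1\<^sup>2 + Z2\<^sup>2) * W2 = W2 - \<kappa>\<^sup>2 * t\<^sup>2" "(X1 * Y1 + X2 * Y2) * W2 = - \<kappa> * \<xi> * b"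
      unfolding gg
      by (simp_all add: g1_def g2_def g3_def b_def W2_def power2_eq_square algebra_simps)
  qed
  have Q: "Q X Y Z = X\<^sup>2 * b - \<kappa> * (X\<^sup>2 + Z\<^sup>2) + 2 * \<kappa> * \<xi> * (X * Y) - 2 * \<kappa> * \<xi>\<^sup>2 * Y\<^sup>2
      + Y\<^sup>2 * ((L + 1) / \<epsilon>)"
    if "g1 * X + g2 * Y + g3 * Z = 0" for X Y Z
  proof -
    \<comment> \<open>The derivative \<open>s'\<close> of \<open>s\<close> in a tangent direction is a multiple of the vertical component \<open>Y\<close>,
      so the square of \<open>s'\<close> in \<open>Q\<close> turns into a term in \<open>Y\<^sup>2\<close>, with the large factor \<open>1 / \<epsilon>\<close>.\<close>
    define s' where "s' = 2 * \<xi> * (X - \<xi> * Y) + 2 * t * Z"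
    have "\<epsilon> * k * s' = - Y"
      using that by (simp add: g1_def g2_def g3_def \<kappa>_def s'_def power2_eq_square algebra_simps)
    then have s': "s' = - (Y * (s * L) / \<epsilon>)" using \<epsilon> L1 s2 by (simp add: k_def field_simps)
    have "\<epsilon> * ((1 + 1 / L) / (s\<^sup>2 * L) * s'\<^sup>2) = Y\<^sup>2 * ((L + 1) / \<epsilon>)"
      unfolding s' using \<epsilon> L1 s2 by (simp add: field_simps power2_eq_square)
    moreover have "Q X Y Z = X\<^sup>2 - \<epsilon> * (2 * k * ((X - \<xi> * Y)\<^sup>2 + Z\<^sup>2 + \<xi>\<^sup>2 * (X\<^sup>2 + Y\<^sup>2)))
        + \<epsilon> * ((1 + 1 / L) / (s\<^sup>2 * L) * s'\<^sup>2)"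
      by (simp add: Q_def s'_def right_diff_distrib)
    ultimately show ?thesis
      by (simp add: b_def \<kappa>_def power2_eq_square algebra_simps)
  qed
  define T where "T = Q X1 Y1 Z1 + Q X2 Y2 Z2"
  have "T = (X1\<^sup>2 + X2\<^sup>2) * (b - \<kappa>) - \<kappa> * (Z1\<^sup>2 + Z2\<^sup>2) + 2 * \<kappa> * \<xi> * (X1 * Y1 + X2 * Y2)
      + (Y1\<^sup>2 + Y2\<^sup>2) * ((L + 1) / \<epsilon> - 2 * \<kappa> * \<xi>\<^sup>2)"
    unfolding T_def Q[OF tan(1)] Q[OF tan(2)] by (simp add: algebra_simps)
  then have "T * W2 = ((X1\<^sup>2 + X2\<^sup>2) * W2) * (b - \<kappa>) - \<kappa> * ((Z1\<^sup>2 + Z2\<^sup>2) * W2)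
      + 2 * \<kappa> * \<xi> * ((X1 * Y1 + X2 * Y2) * W2)
      + ((Y1\<^sup>2 + Y2\<^sup>2) * W2) * ((L + 1) / \<epsilon> - 2 * \<kappa> * \<xi>\<^sup>2)"
    by (simp only:) (simp add: algebra_simps)
  also have "\<dots> = (W2 - \<kappa>\<^sup>2 * \<xi>\<^sup>2) * (b - \<kappa>) - \<kappa> * (W2 - \<kappa>\<^sup>2 * t\<^sup>2)
      + 2 * \<kappa> * \<xi> * (- \<kappa> * \<xi> * b) + E * ((L + 1) / \<epsilon> - 2 * \<kappa> * \<xi>\<^sup>2)"
    unfolding sums ..
  also have "E * ((L + 1) / \<epsilon> - 2 * \<kappa> * \<xi>\<^sup>2) = 2 * \<kappa> + E / \<epsilon> - 2 * (\<kappa> * \<xi>\<^sup>2) * E"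
    using EL \<epsilon> by (simp add: field_simps)
  also have "(W2 - \<kappa>\<^sup>2 * \<xi>\<^sup>2) * (b - \<kappa>) - \<kappa> * (W2 - \<kappa>\<^sup>2 * t\<^sup>2) + 2 * \<kappa> * \<xi> * (- \<kappa> * \<xi> * b)
      + (2 * \<kappa> + E / \<epsilon> - 2 * (\<kappa> * \<xi>\<^sup>2) * E)
    = W2 * b + 2 * \<kappa> * (1 - W2) + \<kappa> * E - 3 * b * (\<kappa>\<^sup>2 * \<xi>\<^sup>2) + E / \<epsilon> - 2 * (\<kappa> * \<xi>\<^sup>2) * E"
    by (simp add: E_def s_def power2_eq_square algebra_simps)
  finally have T: "T * W2 = W2 * b + 2 * \<kappa> * (1 - W2) + \<kappa> * E - 3 * b * (\<kappa>\<^sup>2 * \<xi>\<^sup>2) + E / \<epsilon>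
      - 2 * (\<kappa> * \<xi>\<^sup>2) * E" .
  \<comment> \<open>In \<open>T\<close> the term \<open>E / \<epsilon>\<close> has to dominate; the next four facts compare all terms with \<open>E\<close>.\<close>
  have i1: "2 * \<kappa> * (1 - W2) \<ge> - 2 * \<kappa> * E"
  proof -
    have "b\<^sup>2 \<le> 1" using b by (simp add: power_le_one)
    then have "2 * \<kappa> * (- E) \<le> 2 * \<kappa> * (1 - W2)"
      using \<kappa>0 by (intro mult_left_mono) (auto simp: W2_def)
    then show ?thesis by simp
  qed
  have i2: "3 * b * (\<kappa>\<^sup>2 * \<xi>\<^sup>2) \<le> 3 * E"
  proof -
    have "\<kappa>\<^sup>2 * \<xi>\<^sup>2 \<le> E" by (simp add: E_def s_def mult_left_mono)
    then have "b * (\<kappa>\<^sup>2 * \<xi>\<^sup>2) \<le> 1 * E" using b by (intro mult_mono) auto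
    then show ?thesis by simp
  qed
  have i3: "E / \<epsilon> \<ge> 10 * E"
    using mult_left_mono[of "10 * \<epsilon>" 1 E] \<epsilon> E0 by (simp add: field_simps)
  have i4: "\<kappa> * E \<le> 1/10 * E" "(\<kappa> * \<xi>\<^sup>2) * E \<le> 1/5 * E"
    using mult_right_mono[OF \<kappa>0(2) E0] mult_right_mono[OF \<kappa>\<xi>(2) E0] .
  have lower: "T * W2 \<ge> W2 * b + 6 * E" using T i1 i2 i3 i4 E0 by (simp add: algebra_simps)
  \<comment> \<open>The tangent line of the square root at \<open>b\<^sup>2\<close> bounds \<open>W = sqrt (b\<^sup>2 + E)\<close> linearly in \<open>E\<close>.\<close>
  have W_le: "W \<le> b + E / (2 * b)"
  proof -
    have "W2 \<le> (b + E / (2 * b))\<^sup>2"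
      using b E0 by (simp add: W2_def power2_eq_square field_simps)
    then show ?thesis using b E0 by (simp add: W_def real_le_lsqrt)
  qed
  have "W2 * W \<le> W2 * b + W2 * (E / (2 * b))"
    using mult_left_mono[OF W_le, of W2] W2 by (simp add: distrib_left)
  also have "W2 * (E / (2 * b)) \<le> 2 * E"
  proof -
    have "W2 \<le> 2" using E1 b power_le_one[of b 2] by (simp add: W2_def)
    moreover have "E / (2 * b) \<le> E" using b E0 by (simp add: field_simps mult_le_cancel_left1)
    ultimately show ?thesis using W2 E0 b by (intro mult_mono) auto
  qed
  finally have "W2 * W \<le> W2 * T" using lower E0 by (simp add: mult.commute)
  then have "W \<le> T" using W2 by simp
  then show ?thesis by (simp add: W_def g T_def)
qed

text \<open>
  On the horocylinder of height \<open>y\<close> the induced metric is flat, with Euclidean coordinates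
  \<open>x / y\<close> and \<open>t\<close>; this is the squared distance from the origin in these coordinates.
\<close>

definition horo_dist2 :: "complex \<times> real \<Rightarrow> real" where
  "horo_dist2 p = (Re (fst p) / Im (fst p))\<^sup>2 + (snd p)\<^sup>2"

text \<open>
  A correction of the Busemann function \<open>- ln y\<close> that makes it tend to \<open>-\<infinity>\<close> along the horocylinders.
  Since the plane is parabolic, no correction of this kind can be made on a whole horocylinder;
  this one is used where \<open>horo_dist2 \<ge> e\<close>.
\<close>

definition loglog_barrier :: "real \<Rightarrow> complex \<times> real \<Rightarrow> real" where
  "loglog_barrier \<epsilon> p = - ln (Im (fst p)) - \<epsilon> * ln (ln (horo_dist2 p))"

lemma jet2_divide:
  fixes f g :: "real \<Rightarrow> real"
  assumes "jet2 f f1 f2" "jet2 g g1 g2" "g 0 \<noteq> 0"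
  shows "jet2 (\<lambda>\<tau>. f \<tau> / g \<tau>) (f1 / g 0 - f 0 / g 0 * (g1 / g 0))
    (f2 / g 0 - 2 * (f1 / g 0) * (g1 / g 0) - f 0 / g 0 * (g2 / g 0) + 2 * (f 0 / g 0) * (g1 / g 0)\<^sup>2)"
proof -
  have "f1 * inverse (g 0) + f 0 * (- g1 / (g 0)\<^sup>2) = f1 / g 0 - f 0 / g 0 * (g1 / g 0)"
    by (simp add: divide_inverse power2_eq_square)
  moreover have "f2 * inverse (g 0) + 2 * f1 * (- g1 / (g 0)\<^sup>2)
      + f 0 * (2 * g1\<^sup>2 / g 0 ^ 3 - g2 / (g 0)\<^sup>2)
    = f2 / g 0 - 2 * (f1 / g 0) * (g1 / g 0) - f 0 / g 0 * (g2 / g 0) + 2 * (f 0 / g 0) * (g1 / g 0)\<^sup>2"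
    by (simp add: divide_inverse algebra_simps power2_eq_square power3_eq_cube)
  ultimately show ?thesis
    using jet2_mult[OF assms(1) jet2_inverse[OF assms(2,3)]]
    unfolding divide_inverse[of "f _" "g _"] by (simp only:)
qed

text \<open>
  The second derivative is sorted into a quadratic form in the velocity and a linear form in the
  covariant acceleration \<open>c\<close>, as the maximum principle requires it.
\<close>

lemma jet2_horo_dist2:
  assumes j: "jet2 \<gamma> v a" "\<gamma> 0 = p" and y: "Im (fst p) = y" "y > 0"
    and \<xi>: "Re (fst p) / y = \<xi>"
    and X: "Re (fst v) / y = X" and Y: "Im (fst v) / y = Y"
    and c: "a + christoffel p v v = c"
  shows "jet2 (\<lambda>\<tau>. horo_dist2 (\<gamma> \<tau>)) (2 * \<xi> * (X - \<xi> * Y) + 2 * snd p * snd v)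
    (2 * ((X - \<xi> * Y)\<^sup>2 + (snd v)\<^sup>2 + \<xi>\<^sup>2 * (X\<^sup>2 + Y\<^sup>2))
      + 2 * (\<xi> * (Re (fst c) / y) - \<xi>\<^sup>2 * (Im (fst c) / y) + snd p * snd c))"
proof -
  note co = jet2_coordinates[OF j(1)]
  have cX: "Re (fst c) / y = Re (fst a) / y - 2 * X * Y"
    using y by (simp add: X[symmetric] Y[symmetric] c[symmetric] christoffel_same add_divide_distrib
        diff_divide_distrib)
  have cY: "Im (fst c) / y = Im (fst a) / y + X\<^sup>2 - Y\<^sup>2"
    using y by (simp add: X[symmetric] Y[symmetric] c[symmetric] christoffel_same
        add_divide_distrib diff_divide_distrib power2_eq_square)
  have s: "snd c = snd a" by (simp add: c[symmetric] christoffel_same)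
  have "jet2 (\<lambda>\<tau>. Re (fst (\<gamma> \<tau>)) / Im (fst (\<gamma> \<tau>))) (X - \<xi> * Y)
      (Re (fst a) / y - 2 * X * Y - \<xi> * (Im (fst a) / y) + 2 * \<xi> * Y\<^sup>2)"
    using jet2_divide[OF co(1,2)] y(2) unfolding j(2) y(1) X Y \<xi> by simp
  then have "jet2 (\<lambda>\<tau>. Re (fst (\<gamma> \<tau>)) / Im (fst (\<gamma> \<tau>))) (X - \<xi> * Y)
      (Re (fst c) / y - \<xi> * (Im (fst c) / y) + \<xi> * (X\<^sup>2 + Y\<^sup>2))" (is "jet2 _ _ ?\<xi>2")
    unfolding cX cY by (simp add: algebra_simps)
  from jet2_add[OF jet2_mult[OF this this] jet2_mult[OF co(3) co(3)]]
  have "jet2 (\<lambda>\<tau>. horo_dist2 (\<gamma> \<tau>))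
      ((X - \<xi> * Y) * \<xi> + \<xi> * (X - \<xi> * Y) + (snd v * snd p + snd p * snd v))
      (?\<xi>2 * \<xi> + 2 * (X - \<xi> * Y) * (X - \<xi> * Y) + \<xi> * ?\<xi>2
        + (snd a * snd p + 2 * snd v * snd v + snd p * snd a))"
    unfolding j(2) y(1) \<xi> by (simp add: horo_dist2_def power2_eq_square)
  moreover have "(X - \<xi> * Y) * \<xi> + \<xi> * (X - \<xi> * Y) + (snd v * snd p + snd p * snd v)
      = 2 * \<xi> * (X - \<xi> * Y) + 2 * snd p * snd v" by simp
  moreover have "?\<xi>2 * \<xi> + 2 * (X - \<xi> * Y) * (X - \<xi> * Y) + \<xi> * ?\<xi>2
        + (snd a * snd p + 2 * snd v * snd v + snd p * snd a)
      = 2 * ((X - \<xi> * Y)\<^sup>2 + (snd v)\<^sup>2 + \<xi>\<^sup>2 * (X\<^sup>2 + Y\<^sup>2))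
      + 2 * (\<xi> * (Re (fst c) / y) - \<xi>\<^sup>2 * (Im (fst c) / y) + snd p * snd c)"
    unfolding s power2_eq_square by (simp add: algebra_simps)
  ultimately show ?thesis by (simp only:)
qed

text \<open>
  At a local maximum of the barrier the trace of its Hessian would be smaller than the length
  of its gradient, against \<open>barrier_inequality\<close>.
\<close>

lemma no_touching_loglog_barrier:
  assumes S: "mean_curv_below_half S p" and y: "Im (fst p) > 0"
    and s: "horo_dist2 p \<ge> exp 1" and \<epsilon>: "0 < \<epsilon>" "\<epsilon> \<le> 1 / 10"
    and max: "\<forall>\<^sub>F p' in nhds p. p' \<in> S \<longrightarrow> loglog_barrier \<epsilon> p' \<le> loglog_barrier \<epsilon> p"
  shows False
proof -
  define y where "y = Im (fst p)"
  define \<xi> where "\<xi> = Re (fst p) / y"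
  define s where "s = \<xi>\<^sup>2 + (snd p)\<^sup>2"
  define L where "L = ln s"
  define k where "k = 1 / (s * L)"
  define \<kappa> where "\<kappa> = 2 * \<epsilon> * k"
  have y0: "y > 0" using y by (simp add: y_def)
  have ps: "horo_dist2 p = s" by (simp add: horo_dist2_def s_def \<xi>_def y_def)
  have s1: "s > 1" using s ps exp_ge_add_one_self[of 1] by simp
  then have L0: "L > 0" by (simp add: L_def)
  define q where "q = (\<lambda>X Y Z. X\<^sup>2 - \<epsilon> * (2 * k * ((X - \<xi> * Y)\<^sup>2 + Z\<^sup>2 + \<xi>\<^sup>2 * (X\<^sup>2 + Y\<^sup>2))
    - (1 + 1 / L) / (s\<^sup>2 * L) * (2 * \<xi> * (X - \<xi> * Y) + 2 * snd p * Z)\<^sup>2))"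
  define Q where "Q = (\<lambda>v::complex \<times> real. q (Re (fst v) / y) (Im (fst v) / y) (snd v))"
  define N :: "complex \<times> real" where
    "N = (Complex (y * (- \<kappa> * \<xi>)) (y * (- 1 + \<kappa> * \<xi>\<^sup>2)), - \<kappa> * snd p)"
  have N: "metric p N v = (- \<kappa> * \<xi>) * (Re (fst v) / y) + (- 1 + \<kappa> * \<xi>\<^sup>2) * (Im (fst v) / y)
      + (- \<kappa> * snd p) * snd v" for v
    using y0 by (simp add: metric_frame N_def flip: y_def)
  have jet: "jet2 (\<lambda>\<tau>. loglog_barrier \<epsilon> (\<gamma> \<tau>)) (metric p N v)
      (metric p N (a + christoffel p v v) + Q v)"
    if j: "jet2 \<gamma> v a" "\<gamma> 0 = p" for \<gamma> v a
  proof -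
    define c where "c = a + christoffel p v v"
    define X where "X = Re (fst v) / y"
    define Y where "Y = Im (fst v) / y"
    define s1 where "s1 = 2 * \<xi> * (X - \<xi> * Y) + 2 * snd p * snd v"
    define s2 where "s2 = 2 * ((X - \<xi> * Y)\<^sup>2 + (snd v)\<^sup>2 + \<xi>\<^sup>2 * (X\<^sup>2 + Y\<^sup>2))
      + 2 * (\<xi> * (Re (fst c) / y) - \<xi>\<^sup>2 * (Im (fst c) / y) + snd p * snd c)"
    have "jet2 (\<lambda>\<tau>. horo_dist2 (\<gamma> \<tau>)) s1 s2"
      unfolding s1_def s2_def
      by (rule jet2_horo_dist2[OF j y_def[symmetric] y0 \<xi>_def[symmetric] X_def[symmetric]
            Y_def[symmetric] c_def[symmetric]])
    from jet2_ln[OF this] s1 \<open>s > 1\<close>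
    have "jet2 (\<lambda>\<tau>. ln (horo_dist2 (\<gamma> \<tau>))) (s1 / s) (s2 / s - (s1 / s)\<^sup>2)"
      by (simp add: j(2) ps)
    from jet2_ln[OF this] L0
    have "jet2 (\<lambda>\<tau>. ln (ln (horo_dist2 (\<gamma> \<tau>)))) (s1 / s / L)
        ((s2 / s - (s1 / s)\<^sup>2) / L - (s1 / s / L)\<^sup>2)"
      by (simp add: j(2) ps L_def)
    from jet2_linear[OF this, of "(*) (- \<epsilon>)"]
    have l: "jet2 (\<lambda>\<tau>. - \<epsilon> * ln (ln (horo_dist2 (\<gamma> \<tau>)))) (- \<epsilon> * (s1 / s / L))
        (- \<epsilon> * ((s2 / s - (s1 / s)\<^sup>2) / L - (s1 / s / L)\<^sup>2))"
      by (simp add: bounded_linear_mult_right)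
    have "jet2 (\<lambda>\<tau>. - ln (Im (fst (\<gamma> \<tau>)))) (- Y) (- (Im (fst a) / y - Y\<^sup>2))"
      using jet2_linear[OF jet2_ln[OF jet2_coordinates(2)[OF j(1)]]
          bounded_linear_minus[OF bounded_linear_ident]] j(2) y0
      by (simp add: y_def Y_def)
    from jet2_add[OF this l]
    have "jet2 (\<lambda>\<tau>. loglog_barrier \<epsilon> (\<gamma> \<tau>)) (- Y + - \<epsilon> * (s1 / s / L))
       (- (Im (fst a) / y - Y\<^sup>2) + - \<epsilon> * ((s2 / s - (s1 / s)\<^sup>2) / L - (s1 / s / L)\<^sup>2))"
      by (simp add: loglog_barrier_def)
    moreover have "- Y + - \<epsilon> * (s1 / s / L) = metric p N v"
      using s1 L0 by (simp add: N s1_def \<kappa>_def k_def power2_eq_square algebra_simps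
          add_divide_distrib diff_divide_distrib flip: X_def Y_def)
    moreover have "- (Im (fst a) / y - Y\<^sup>2) + - \<epsilon> * ((s2 / s - (s1 / s)\<^sup>2) / L - (s1 / s / L)\<^sup>2)
        = metric p N c + Q v"
    proof -
      have ay: "Im (fst a) / y = Im (fst c) / y - X\<^sup>2 + Y\<^sup>2"
        using y0 by (simp add: c_def christoffel_same X_def Y_def flip: y_def)
          (simp add: field_simps power2_eq_square)
      have e: "(s2 / s - (s1 / s)\<^sup>2) / L - (s1 / s / L)\<^sup>2 = k * s2 - (1 + 1 / L) / (s\<^sup>2 * L) * s1\<^sup>2"
        using \<open>s > 1\<close> L0 by (simp add: k_def field_simps power2_eq_square)
      define m where "m = (1 + 1 / L) / (s\<^sup>2 * L)"
      show ?thesis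
        unfolding e ay N Q_def q_def
        unfolding m_def[symmetric]
        unfolding X_def[symmetric] Y_def[symmetric]
        unfolding s1_def[symmetric] unfolding s2_def \<kappa>_def
        by (simp add: algebra_simps power2_eq_square)
    qed
    ultimately show ?thesis by (simp add: c_def)
  qed
  have N0: "N \<noteq> 0"
  proof
    assume "N = 0"
    then have "\<kappa> * \<xi> = 0 \<and> - 1 + \<kappa> * \<xi> * \<xi> = 0"
      using y0 by (auto simp: N_def prod_eq_iff complex_eq_iff power2_eq_square)
    then show False by auto
  qed
  obtain v w where vw: "metric p v v = 1" "metric p w w = 1" "metric p v w = 0"
    "metric p N v = 0" "metric p N w = 0" "Q v + Q w < sqrt (metric p N N)"
    by (rule touching_from_above[OF S max N0 jet])
  have "Re (fst N) / y = - \<kappa> * \<xi>" "Im (fst N) / y = - 1 + \<kappa> * \<xi>\<^sup>2"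
    using y0 by (simp_all add: N_def)
  then have "metric p N N = (- \<kappa> * \<xi>)\<^sup>2 + (- 1 + \<kappa> * \<xi>\<^sup>2)\<^sup>2 + (- \<kappa> * snd p)\<^sup>2"
    unfolding N by (simp add: N_def power2_eq_square)
  moreover have "sqrt ((- \<kappa> * \<xi>)\<^sup>2 + (- 1 + \<kappa> * \<xi>\<^sup>2)\<^sup>2 + (- \<kappa> * snd p)\<^sup>2) \<le> Q v + Q w"
    unfolding Q_def q_def
    by (rule barrier_inequality[of \<xi> "snd p" \<epsilon>, folded s_def, folded L_def, folded k_def,
        folded \<kappa>_def, OF s[unfolded ps] \<epsilon>
        vw(1-3)[unfolded metric_frame, folded y_def] vw(4,5)[unfolded N]])
  ultimately show False using vw(6) by simp
qed

section \<open>Surfaces above a horocycle\<close>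

lemma continuous_on_horo_dist2:
  assumes "\<And>p. p \<in> S \<Longrightarrow> Im (fst p) > 0"
  shows "continuous_on S horo_dist2"
  unfolding horo_dist2_def using assms by (intro continuous_intros) force

text \<open>
  The horizontal coordinate is controlled because \<open>|x| = |\<xi>| y\<close>.
\<close>

lemma compact_truncation:
  assumes S: "closed S" and Im: "\<And>p. p \<in> S \<Longrightarrow> Im (fst p) > 0"
  shows "compact {p \<in> S. horo_dist2 p \<le> R \<and> Im (fst p) \<le> Y}"
proof -
  have "closed {p \<in> S. horo_dist2 p \<le> R}"
    by (intro continuous_on_closed_Collect_le S continuous_on_horo_dist2 Im continuous_intros)
  moreover have "closed {p \<in> S. Im (fst p) \<le> Y}"
    by (intro continuous_on_closed_Collect_le S continuous_intros)
  moreover have "{p \<in> S. horo_dist2 p \<le> R \<and> Im (fst p) \<le> Y}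
      = {p \<in> S. horo_dist2 p \<le> R} \<inter> {p \<in> S. Im (fst p) \<le> Y}" by blast
  ultimately have cl: "closed {p \<in> S. horo_dist2 p \<le> R \<and> Im (fst p) \<le> Y}" by auto
  have "norm p \<le> (1 + R) * Y + Y + (1 + R)"
    if p: "p \<in> S" "horo_dist2 p \<le> R" "Im (fst p) \<le> Y" for p
  proof -
    have sq: "\<bar>x\<bar> \<le> 1 + x\<^sup>2" for x :: real
      using zero_le_power2[of "\<bar>x\<bar> - 1/2"] by (simp add: power2_diff power_divide)
    have y: "0 < Im (fst p)" using Im p(1) .
    have R: "(Re (fst p) / Im (fst p))\<^sup>2 \<le> R" "(snd p)\<^sup>2 \<le> R"
      using p(2) unfolding horo_dist2_def by (smt (verit) zero_le_power2)+
    have t: "\<bar>snd p\<bar> \<le> 1 + R" using sq[of "snd p"] R(2) by linarith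
    have "\<bar>Re (fst p) / Im (fst p)\<bar> \<le> 1 + R"
      using sq[of "Re (fst p) / Im (fst p)"] R(1) by linarith
    then have "\<bar>Re (fst p)\<bar> \<le> (1 + R) * Im (fst p)" using y by (simp add: field_simps)
    also have "\<dots> \<le> (1 + R) * Y" using t p(3) by (intro mult_left_mono) auto
    finally have "cmod (fst p) \<le> (1 + R) * Y + Y"
      using cmod_le[of "fst p"] y p(3) by simp
    then show ?thesis using norm_Pair_le[of "fst p" "snd p"] t by simp
  qed
  then have "bounded {p \<in> S. horo_dist2 p \<le> R \<and> Im (fst p) \<le> Y}"
    unfolding bounded_iff by blast
  with cl show ?thesis by (simp add: compact_eq_bounded_closed)
qed

text \<open>
  Let \<open>m\<close> be the infimum of the heights. It is not attained, so on the core
  \<open>horo_dist2 \<le> e\<close> the heights stay above some \<open>m1 > m\<close>, by compactness of its lower part.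
  Take a point \<open>p0\<close> lower than \<open>m1\<close>; it lies outside the core. For small \<open>\<epsilon>\<close> the barrier is larger at \<open>p0\<close> than on the rim
  \<open>horo_dist2 = e\<close>, where the correction vanishes, and it tends to \<open>-\<infinity>\<close> at infinity. So it has
  a maximum strictly outside the core, which the maximum principle excludes.
\<close>

theorem no_surface_above_horocycle:
  assumes S: "closed S" and c: "c > 0" and Im: "\<And>p. p \<in> S \<Longrightarrow> c \<le> Im (fst p)"
    and H: "\<And>p. p \<in> S \<Longrightarrow> mean_curv_below_half S p"
  shows "S = {}"
proof (rule ccontr)
  assume ne: "S \<noteq> {}"
  have Im0: "Im (fst p) > 0" if "p \<in> S" for p using Im[OF that] c by linarith
  define m where "m = (INF p\<in>S. Im (fst p))"
  have bdd: "bdd_below ((\<lambda>p. Im (fst p)) ` S)" using Im by (meson bdd_belowI2)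
  have m0: "m > 0"
    using cINF_greatest[of S c "\<lambda>p. Im (fst p)"] ne Im c unfolding m_def by force
  have m_le: "m \<le> Im (fst p)" if "p \<in> S" for p
    unfolding m_def using bdd that by (rule cINF_lower)
  have m_less: "m < Im (fst p)" if "p \<in> S" for p
  proof (rule ccontr)
    assume "\<not> m < Im (fst p)"
    then have "\<forall>p'. p' \<in> S \<longrightarrow> Im (fst p) \<le> Im (fst p')" using m_le by force
    then show False
      using no_lowest_point[OF H[OF that] Im0[OF that]] by (simp add: always_eventually)
  qed
  \<comment> \<open>The height \<open>2 m\<close> only serves to cut off the upper part of the core, which is not compact.\<close>
  obtain m1 where m1: "m1 > m" "\<And>p. p \<in> S \<Longrightarrow> horo_dist2 p \<le> exp 1 \<Longrightarrow> m1 \<le> Im (fst p)"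
  proof -
    let ?K = "{p \<in> S. horo_dist2 p \<le> exp 1 \<and> Im (fst p) \<le> 2 * m}"
    show thesis
    proof (cases "?K = {}")
      case True
      then show thesis using that[of "2 * m"] m0 by fastforce
    next
      case False
      have "compact ?K" by (rule compact_truncation[OF S Im0])
      then obtain p where p: "p \<in> ?K" "\<And>p'. p' \<in> ?K \<Longrightarrow> Im (fst p) \<le> Im (fst p')"
        using continuous_attains_inf[of ?K "\<lambda>p. Im (fst p)"] False
        by (fastforce intro!: continuous_intros)
      show thesis
      proof (rule that[of "Im (fst p)"])
        show "m < Im (fst p)" using p(1) m_less by blast
        show "Im (fst p) \<le> Im (fst p')" if "p' \<in> S" "horo_dist2 p' \<le> exp 1" for p'
        proof (cases "Im (fst p') \<le> 2 * m")
          case True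
          then show ?thesis using p(2) that by blast
        next
          case False
          then show ?thesis using p(1) by simp
        qed
      qed
    qed
  qed
  obtain p0 where p0: "p0 \<in> S" "Im (fst p0) < m1"
    using cInf_lessD[of "(\<lambda>p. Im (fst p)) ` S" m1] m1(1) ne by (auto simp: m_def)
  have s0: "horo_dist2 p0 > exp 1" using m1(2)[OF p0(1)] p0(2) by force
  have lnln: "0 \<le> ln (ln s)" if "exp 1 \<le> s" for s :: real
    using that by (smt (verit) exp_gt_zero ln_ge_iff ln_ge_zero)
  define l where "l = ln (ln (horo_dist2 p0))"
  have l0: "l \<ge> 0" using s0 lnln by (simp add: l_def)
  define d where "d = ln m1 - ln (Im (fst p0))"
  have d0: "d > 0" using p0 Im0[OF p0(1)] by (simp add: d_def)
  define \<epsilon> where "\<epsilon> = min (1 / 10) (d / (2 * (l + 1)))"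
  have \<epsilon>: "0 < \<epsilon>" using d0 l0 by (simp add: \<epsilon>_def)
  have \<epsilon>': "\<epsilon> \<le> 1 / 10" unfolding \<epsilon>_def by (rule min.cobounded1)
  have "\<epsilon> * l < d"
  proof -
    have "\<epsilon> * l \<le> d / (2 * (l + 1)) * (l + 1)"
    proof (rule mult_mono)
      show "\<epsilon> \<le> d / (2 * (l + 1))" unfolding \<epsilon>_def by (rule min.cobounded2)
    qed (use l0 d0 in auto)
    also have "\<dots> = d / 2" using l0 by (simp add: field_simps)
    finally show ?thesis using d0 by simp
  qed
  define C where "C = loglog_barrier \<epsilon> p0"
  have C: "- ln m1 < C"
    using \<open>\<epsilon> * l < d\<close> by (simp add: C_def loglog_barrier_def d_def l_def)
  \<comment> \<open>\<open>Y\<close> and \<open>R\<close> bound the height and \<open>horo_dist2\<close> of the points outside the core at which the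
    barrier is at least \<open>C\<close>, so that the maximum over \<open>T\<close> is one over all of \<open>S\<close> outside the core.\<close>
  define Y where "Y = exp (- C)"
  define R where "R = exp (exp ((- C - ln m) / \<epsilon>))"
  define T where "T = {p \<in> S. horo_dist2 p \<le> R \<and> Im (fst p) \<le> Y} \<inter> {p \<in> S. exp 1 \<le> horo_dist2 p}"
  have inT: "p \<in> T" if p: "p \<in> S" "exp 1 \<le> horo_dist2 p" "C \<le> loglog_barrier \<epsilon> p" for p
  proof -
    have C': "C + \<epsilon> * ln (ln (horo_dist2 p)) \<le> - ln (Im (fst p))"
      using p(3) by (simp add: loglog_barrier_def)
    have "0 \<le> \<epsilon> * ln (ln (horo_dist2 p))" using lnln[OF p(2)] \<epsilon> by simp
    then have "ln (Im (fst p)) \<le> - C" using C' by linarith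
    then have "Im (fst p) \<le> Y" unfolding Y_def using Im0[OF p(1)]
      by (metis exp_le_cancel_iff exp_ln)
    moreover have "horo_dist2 p \<le> R"
    proof -
      have "ln m \<le> ln (Im (fst p))" using m_le[OF p(1)] m0 Im0[OF p(1)] by simp
      then have "ln (ln (horo_dist2 p)) \<le> (- C - ln m) / \<epsilon>"
        using C' \<epsilon> by (simp add: field_simps)
      moreover have h: "0 < horo_dist2 p" "0 < ln (horo_dist2 p)"
        using p(2) exp_ge_add_one_self[of "1::real"] by auto
      ultimately have "ln (horo_dist2 p) \<le> exp ((- C - ln m) / \<epsilon>)"
        by (metis exp_le_cancel_iff exp_ln)
      then show ?thesis unfolding R_def using h(1) by (metis exp_le_cancel_iff exp_ln)
    qed
    ultimately show ?thesis using p by (simp add: T_def)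
  qed
  have T_ne: "T \<noteq> {}" using inT[of p0] p0 s0 by (force simp: C_def)
  have "compact T"
    unfolding T_def
    by (intro compact_Int_closed compact_truncation S Im0 continuous_on_closed_Collect_le
        continuous_on_horo_dist2 continuous_intros)
  moreover have "continuous_on T (loglog_barrier \<epsilon>)"
  proof -
    have pos: "0 < Im (fst p)" "1 < horo_dist2 p" if "p \<in> T" for p
      using that Im0[of p] exp_ge_add_one_self[of "1::real"] by (auto simp: T_def)
    then have "ln (horo_dist2 p) > 0" if "p \<in> T" for p using pos(2)[OF that] by simp
    then show ?thesis
      unfolding loglog_barrier_def using pos
      by (intro continuous_intros continuous_on_horo_dist2) force+
  qed
  ultimately obtain p1 where p1: "p1 \<in> T" "\<And>p. p \<in> T \<Longrightarrow> loglog_barrier \<epsilon> p \<le> loglog_barrier \<epsilon> p1"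
    using continuous_attains_sup[of T] T_ne by blast
  have p1S: "p1 \<in> S" and p1e: "exp 1 \<le> horo_dist2 p1" using p1(1) by (auto simp: T_def)
  have C1: "C \<le> loglog_barrier \<epsilon> p1"
    using inT[of p0] p0 s0 p1(2)[of p0] by (simp add: C_def)
  have "exp 1 < horo_dist2 p1"
  proof (rule ccontr)
    assume "\<not> exp 1 < horo_dist2 p1"
    then have e: "horo_dist2 p1 = exp 1" using p1e by simp
    then have "m1 \<le> Im (fst p1)" using m1(2)[OF p1S] by simp
    then have "- ln (Im (fst p1)) \<le> - ln m1" using m1(1) m0 by simp
    then show False using C C1 by (simp add: loglog_barrier_def e)
  qed
  moreover have "isCont horo_dist2 p1"
    unfolding horo_dist2_def[abs_def] using Im0[OF p1S]
    by (intro continuous_intros isCont_Im isCont_fst) simp_all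
  ultimately have "\<forall>\<^sub>F p in nhds p1. exp 1 < horo_dist2 p"
    using order_tendstoD(1)[of horo_dist2 "horo_dist2 p1" "nhds p1" "exp 1"]
      tendsto_at_iff_tendsto_nhds[of horo_dist2 p1] by (simp add: isCont_def)
  then have "\<forall>\<^sub>F p in nhds p1. p \<in> S \<longrightarrow> loglog_barrier \<epsilon> p \<le> loglog_barrier \<epsilon> p1"
    by eventually_elim (use inT p1(2) C1 in force)
  then show False
    by (rule no_touching_loglog_barrier[OF H[OF p1S] Im0[OF p1S] p1e \<epsilon> \<epsilon>'])
qed

section \<open>Invariance under inversion\<close>

lemma jet2_Pair:
  assumes "jet2 \<gamma> v a" "jet2 \<delta> w b"
  shows "jet2 (\<lambda>\<tau>. (\<gamma> \<tau>, \<delta> \<tau>)) (v, w) (a, b)"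
proof -
  have "jet2 (\<lambda>\<tau>. (\<gamma> \<tau>, 0) + (0, \<delta> \<tau>)) ((v, 0) + (0, w)) ((a, 0) + (0, b))"
    by (intro jet2_add jet2_linear[OF assms(1), of "\<lambda>x. (x, 0)"]
        jet2_linear[OF assms(2), of "\<lambda>x. (0, x)"] bounded_linear_Pair bounded_linear_ident
        bounded_linear_zero)
  then show ?thesis by simp
qed

text \<open>
  The isometry \<open>(z, t) \<mapsto> (- 1 / (z - a), t)\<close> sends the ideal point \<open>a\<close> to infinity, and thereby
  the horoballs at \<open>a\<close> to half-planes.
\<close>

definition inversion :: "real \<Rightarrow> complex \<times> real \<Rightarrow> complex \<times> real" where
  "inversion a p = (- inverse (fst p - of_real a), snd p)"

definition dinversion :: "real \<Rightarrow> complex \<times> real \<Rightarrow> complex \<times> real \<Rightarrow> complex \<times> real" where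
  "dinversion a p v = (fst v / (fst p - of_real a)\<^sup>2, snd v)"

lemma Im_inversion: "Im (fst (inversion a p)) = Im (fst p) / (cmod (fst p - of_real a))\<^sup>2"
  by (simp add: inversion_def cmod_power2)

lemma metric_dinversion:
  assumes "Im (fst p) > 0"
  shows "metric (inversion a p) (dinversion a p v) (dinversion a p w) = metric p v w"
proof -
  define z where "z = fst p - of_real a"
  have "z \<noteq> 0" using assms by (auto simp: z_def complex_eq_iff)
  then have n: "norm z > 0" by simp
  have "(fst v / z\<^sup>2) \<bullet> (fst w / z\<^sup>2) = (fst v \<bullet> fst w) / (norm z)\<^sup>2 ^ 2"
  proof -
    have ip: "x \<bullet> y = Re (x * cnj y)" for x y by (simp add: inner_complex_def)
    have *: "fst v / z\<^sup>2 * cnj (fst w / z\<^sup>2) = fst v * cnj (fst w) / of_real ((norm z)\<^sup>2 ^ 2)"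
    proof -
      have "complex_of_real ((norm z)\<^sup>2 ^ 2) = (z * cnj z)\<^sup>2"
        by (simp only: of_real_power[of "(norm z)\<^sup>2"] complex_norm_square)
      then show ?thesis by (simp only:) (simp add: power2_eq_square mult_ac)
    qed
    show ?thesis unfolding ip * Re_divide_of_real ..
  qed
  then show ?thesis
    using n assms by (simp add: metric_def dinversion_def Im_inversion flip: z_def)
      (simp add: inversion_def field_simps)
qed

text \<open>
  The pair on the left is the flat second derivative of the image curve. The failure of the
  inversion to be affine, \<open>- 2 v\<^sup>2 / z\<^sup>3\<close>, is compensated by the change of the Christoffel term,
  because \<open>z\<close> and its conjugate differ by \<open>2 \<i> y\<close>.
\<close>

lemma christoffel_inversion:
  assumes y: "Im (fst p) > 0"
  shows "(fst a / (fst p - of_real b)\<^sup>2 - 2 * (fst v)\<^sup>2 / (fst p - of_real b) ^ 3, snd a)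
      + christoffel (inversion b p) (dinversion b p v) (dinversion b p v)
    = dinversion b p (a + christoffel p v v)"
proof -
  define z where "z = fst p - of_real b"
  define y where "y = Im (fst p)"
  have z0: "z \<noteq> 0" using assms by (auto simp: z_def complex_eq_iff)
  have y0: "complex_of_real y \<noteq> 0" using assms by (simp add: y_def)
  have "\<i> * cnj z = \<i> * z + 2 * of_real y" by (simp add: complex_eq_iff z_def y_def)
  have Iq: "complex_of_real (Im (fst (inversion b p))) = of_real y / (z * cnj z)"
    unfolding Im_inversion y_def z_def of_real_divide complex_norm_square ..
  have "\<i> * (fst v / z\<^sup>2) * (fst v / z\<^sup>2) / of_real (Im (fst (inversion b p)))
      = (fst v)\<^sup>2 * (\<i> * cnj z) / (z ^ 3 * of_real y)"
    unfolding Iq using z0 y0 by (simp add: field_simps power2_eq_square power3_eq_cube)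
  also have "\<dots> = (fst v)\<^sup>2 * \<i> / (z\<^sup>2 * of_real y) + 2 * (fst v)\<^sup>2 / z ^ 3"
    unfolding \<open>\<i> * cnj z = _\<close> using z0 y0
    by (simp add: field_simps power2_eq_square power3_eq_cube)
  finally have "\<i> * (fst v / z\<^sup>2) * (fst v / z\<^sup>2) / of_real (Im (fst (inversion b p)))
      = (fst v)\<^sup>2 * \<i> / (z\<^sup>2 * of_real y) + 2 * (fst v)\<^sup>2 / z ^ 3" .
  then have *: "fst a / z\<^sup>2 - 2 * (fst v)\<^sup>2 / z ^ 3
      + \<i> * (fst v / z\<^sup>2) * (fst v / z\<^sup>2) / of_real (Im (fst (inversion b p)))
    = (fst a + \<i> * fst v * fst v / of_real y) / z\<^sup>2"
    using z0 y0 by (simp add: add_divide_distrib power2_eq_square mult_ac)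
  show ?thesis
    unfolding prod_eq_iff christoffel_def dinversion_def
    using * by (simp add: y_def flip: z_def)
qed

lemma jet2_inversion:
  assumes j: "jet2 \<gamma> v a" and p: "\<gamma> 0 = p" "Im (fst p) > 0"
  shows "jet2 (\<lambda>\<tau>. inversion b (\<gamma> \<tau>)) (dinversion b p v)
    (fst a / (fst p - of_real b)\<^sup>2 - 2 * (fst v)\<^sup>2 / (fst p - of_real b) ^ 3, snd a)"
proof -
  have const: "jet2 (\<lambda>\<tau>. - complex_of_real b) 0 0"
    unfolding jet2_def by (intro exI[of _ "\<lambda>_. 0"]) auto
  have "jet2 (\<lambda>\<tau>. fst (\<gamma> \<tau>) - of_real b) (fst v) (fst a)"
    using jet2_add[OF jet2_linear[OF j bounded_linear_fst] const] by simp
  moreover have "fst p - of_real b \<noteq> 0" using p by (auto simp: complex_eq_iff)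
  ultimately have "jet2 (\<lambda>\<tau>. inverse (fst (\<gamma> \<tau>) - of_real b)) (- fst v / (fst p - of_real b)\<^sup>2)
      (2 * (fst v)\<^sup>2 / (fst p - of_real b) ^ 3 - fst a / (fst p - of_real b)\<^sup>2)"
    using jet2_inverse p by fastforce
  from jet2_linear[OF this bounded_linear_minus[OF bounded_linear_ident]]
  have "jet2 (\<lambda>\<tau>. - inverse (fst (\<gamma> \<tau>) - of_real b)) (fst v / (fst p - of_real b)\<^sup>2)
      (fst a / (fst p - of_real b)\<^sup>2 - 2 * (fst v)\<^sup>2 / (fst p - of_real b) ^ 3)"
    by simp
  from jet2_Pair[OF this jet2_linear[OF j bounded_linear_snd]]
  show ?thesis by (simp add: inversion_def dinversion_def)
qed

text \<open>
  Velocities and covariant accelerations of the two curves are transported by the differential,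
  which is a linear isometry onto the tangent space at the image point.
\<close>

lemma mean_curv_below_half_inversion:
  assumes S: "mean_curv_below_half S p" and y: "Im (fst p) > 0"
  shows "mean_curv_below_half (inversion b ` S) (inversion b p)"
proof -
  obtain \<gamma>1 v1 a1 \<gamma>2 v2 a2 where g:
    "jet2 \<gamma>1 v1 a1" "jet2 \<gamma>2 v2 a2" "\<gamma>1 0 = p" "\<gamma>2 0 = p"
    "\<forall>\<^sub>F \<tau> in nhds 0. \<gamma>1 \<tau> \<in> S" "\<forall>\<^sub>F \<tau> in nhds 0. \<gamma>2 \<tau> \<in> S"
    "metric p v1 v1 = 1" "metric p v2 v2 = 1" "metric p v1 v2 = 0"
    and H: "\<And>N. metric p N v1 = 0 \<Longrightarrow> metric p N v2 = 0 \<Longrightarrow> N \<noteq> 0 \<Longrightarrow>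
         \<bar>metric p N (a1 + christoffel p v1 v1) + metric p N (a2 + christoffel p v2 v2)\<bar>
           < sqrt (metric p N N)"
    using S unfolding mean_curv_below_half_def by blast
  have z0: "fst p - of_real b \<noteq> 0" using y by (auto simp: complex_eq_iff)
  have surj: "\<exists>N. N' = dinversion b p N" for N'
    using z0 by (intro exI[of _ "(fst N' * (fst p - of_real b)\<^sup>2, snd N')"])
      (simp add: dinversion_def)
  have zero: "dinversion b p 0 = 0" by (simp add: dinversion_def prod_eq_iff)
  note m = metric_dinversion[OF y]
  show ?thesis
    unfolding mean_curv_below_half_def
  proof (intro exI conjI)
    show "jet2 (\<lambda>\<tau>. inversion b (\<gamma>1 \<tau>)) (dinversion b p v1)
        (fst a1 / (fst p - of_real b)\<^sup>2 - 2 * (fst v1)\<^sup>2 / (fst p - of_real b) ^ 3, snd a1)"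
      by (rule jet2_inversion[OF g(1,3) y])
    show "jet2 (\<lambda>\<tau>. inversion b (\<gamma>2 \<tau>)) (dinversion b p v2)
        (fst a2 / (fst p - of_real b)\<^sup>2 - 2 * (fst v2)\<^sup>2 / (fst p - of_real b) ^ 3, snd a2)"
      by (rule jet2_inversion[OF g(2,4) y])
    show "\<forall>\<^sub>F \<tau> in nhds 0. inversion b (\<gamma>1 \<tau>) \<in> inversion b ` S"
      using g(5) by eventually_elim (rule imageI)
    show "\<forall>\<^sub>F \<tau> in nhds 0. inversion b (\<gamma>2 \<tau>) \<in> inversion b ` S"
      using g(6) by eventually_elim (rule imageI)
  qed (use g m H zero surj christoffel_inversion[OF y] in \<open>auto, metis\<close>)
qed

section \<open>Mean curvature of an immersion by means of two curves\<close>

lemma metric_commute: "metric p v w = metric p w v"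
  by (simp add: metric_def inner_commute mult.commute)

lemma linear_metric: "linear (metric p N)"
  by (rule linearI) (simp_all add: metric_def inner_add_right add_divide_distrib algebra_simps)

lemma metric_pos:
  assumes "Im (fst p) > 0" "v \<noteq> 0"
  shows "0 < metric p v v"
proof (cases "fst v = 0")
  case True
  then have "snd v \<noteq> 0" using assms(2) by (simp add: prod_eq_iff)
  then have "0 < snd v * snd v" by (metis not_real_square_gt_zero)
  then show ?thesis using True by (simp add: metric_def)
next
  case False
  then have "0 < (fst v \<bullet> fst v) / (Im (fst p))\<^sup>2" using assms(1) by simp
  then show ?thesis by (simp add: metric_def add_pos_nonneg)
qed

lemma metric_Cauchy_Schwarz:
  "\<bar>metric p v w\<bar> \<le> sqrt (metric p v v) * sqrt (metric p w w)"
proof -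
  define h where "h = (\<lambda>v::complex \<times> real. (fst v /\<^sub>R Im (fst p), snd v))"
  have "metric p v w = h v \<bullet> h w" for v w
    by (simp add: metric_def h_def inner_prod_def power2_eq_square divide_inverse)
  then show ?thesis
    using Cauchy_Schwarz_ineq2[of "h v" "h w"] by (simp add: norm_eq_sqrt_inner)
qed

lemma frechet_derivative_partial:
  assumes "f differentiable (at x)"
  shows "frechet_derivative f (at x) v = (\<Sum>i\<in>UNIV. (v $ i) *\<^sub>R partial i f x)"
proof -
  have lin: "linear (frechet_derivative f (at x))"
    using assms by (rule linear_frechet_derivative)
  have "frechet_derivative f (at x) v = frechet_derivative f (at x) (\<Sum>i\<in>UNIV. (v $ i) *\<^sub>R axis i 1)"
    using basis_expansion[of v] by (simp add: scalar_mult_eq_scaleR)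
  then show ?thesis
    by (simp add: linear_sum[OF lin] linear_scale[OF lin] partial_def)
qed

lemma has_vector_derivative_along_line:
  assumes "f differentiable (at (q + \<tau> *\<^sub>R v))"
  shows "((\<lambda>\<tau>. f (q + \<tau> *\<^sub>R v)) has_vector_derivative
    (\<Sum>i\<in>UNIV. (v $ i) *\<^sub>R partial i f (q + \<tau> *\<^sub>R v))) (at \<tau>)"
proof -
  have "((\<lambda>\<tau>. q + \<tau> *\<^sub>R v) has_derivative (\<lambda>h. h *\<^sub>R v)) (at \<tau>)"
    by (auto intro!: derivative_eq_intros)
  from diff_chain_at[OF this, of f] assms
  have d: "((\<lambda>\<tau>. f (q + \<tau> *\<^sub>R v)) has_derivative
      (\<lambda>h. frechet_derivative f (at (q + \<tau> *\<^sub>R v)) (h *\<^sub>R v))) (at \<tau>)"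
    by (simp add: frechet_derivative_works o_def)
  show ?thesis
    unfolding has_vector_derivative_def frechet_derivative_partial[OF assms, symmetric]
    using d by (simp add: linear_scale[OF linear_frechet_derivative[OF assms]])
qed

lemma jet2_along_line:
  assumes C2: "C_k_on 2 U F" and U: "open U" "q \<in> U"
  shows "jet2 (\<lambda>\<tau>. F (q + \<tau> *\<^sub>R v)) (\<Sum>i\<in>UNIV. (v $ i) *\<^sub>R partial i F q)
    (\<Sum>j\<in>UNIV. \<Sum>i\<in>UNIV. (v $ j * v $ i) *\<^sub>R partial i (partial j F) q)"
proof -
  have d1: "F differentiable (at x)" if "x \<in> U" for x
    using C2 that by (simp add: eval_nat_numeral)
  have d2: "partial j F differentiable (at q)" for j
    using C2 U(2) by (auto simp: eval_nat_numeral partial_def[abs_def])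
  have "isCont (\<lambda>\<tau>. q + \<tau> *\<^sub>R v) 0" by (intro continuous_intros)
  then have "\<forall>\<^sub>F \<tau> in nhds 0. q + \<tau> *\<^sub>R v \<in> U"
    using U tendsto_at_iff_tendsto_nhds[of "\<lambda>\<tau>. q + \<tau> *\<^sub>R v" 0]
    by (auto simp: isCont_def dest: topological_tendstoD)
  then have "\<forall>\<^sub>F \<tau> in nhds 0. ((\<lambda>\<tau>. F (q + \<tau> *\<^sub>R v)) has_vector_derivative
      (\<Sum>j\<in>UNIV. (v $ j) *\<^sub>R partial j F (q + \<tau> *\<^sub>R v))) (at \<tau>)"
    by eventually_elim (intro has_vector_derivative_along_line d1)
  moreover have "((\<lambda>\<tau>. \<Sum>j\<in>UNIV. (v $ j) *\<^sub>R partial j F (q + \<tau> *\<^sub>R v)) has_vector_derivative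
      (\<Sum>j\<in>UNIV. (v $ j) *\<^sub>R (\<Sum>i\<in>UNIV. (v $ i) *\<^sub>R partial i (partial j F) q))) (at 0)"
  proof (rule has_vector_derivative_sum)
    fix j
    have "((\<lambda>\<tau>. partial j F (q + \<tau> *\<^sub>R v)) has_vector_derivative
      (\<Sum>i\<in>UNIV. (v $ i) *\<^sub>R partial i (partial j F) q)) (at 0)"
      using has_vector_derivative_along_line[of "partial j F" q 0 v] d2 by simp
    then show "((\<lambda>\<tau>. (v $ j) *\<^sub>R partial j F (q + \<tau> *\<^sub>R v)) has_vector_derivative
      (v $ j) *\<^sub>R (\<Sum>i\<in>UNIV. (v $ i) *\<^sub>R partial i (partial j F) q)) (at 0)"
      by (rule bounded_linear.has_vector_derivative[OF bounded_linear_scaleR_right])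
  qed
  ultimately show ?thesis
    unfolding jet2_def
    by (intro exI[of _ "\<lambda>\<tau>. \<Sum>j\<in>UNIV. (v $ j) *\<^sub>R partial j F (q + \<tau> *\<^sub>R v)"])
      (simp add: scaleR_sum_right)
qed

lemma matrix_inv_eqI:
  fixes A :: "real^'n^'n"
  assumes "A ** B = mat 1"
  shows "matrix_inv A = B"
proof -
  have BA: "B ** A = mat 1" using assms matrix_left_right_inverse by blast
  have "A ** matrix_inv A = mat 1 \<and> matrix_inv A ** A = mat 1"
    unfolding matrix_inv_def by (rule someI[of _ B]) (use assms BA in auto)
  then have "matrix_inv A = (B ** A) ** matrix_inv A" using BA by simp
  also have "\<dots> = B ** (A ** matrix_inv A)" by (rule matrix_mul_assoc[symmetric])
  finally show ?thesis using \<open>A ** matrix_inv A = mat 1 \<and> _\<close> by simp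
qed

text \<open>
  Gram-Schmidt for the first fundamental form. If \<open>V\<close> has columns \<open>v1\<close> and \<open>v2\<close>, orthonormality
  means \<open>V\<^sup>T g V = 1\<close>, and then \<open>g\<^sup>-\<^sup>1 = V V\<^sup>T\<close>: a trace with \<open>g\<^sup>-\<^sup>1\<close> is the sum of two second derivatives
  along straight lines in the parameter domain.
\<close>

lemma orthonormal_parameter_frame:
  assumes p: "Im (fst (F q)) > 0" and d: "F differentiable (at q)"
    and inj: "inj (frechet_derivative F (at q))"
  obtains v1 v2 :: "real^2" where
    "metric (F q) (frechet_derivative F (at q) v1) (frechet_derivative F (at q) v1) = 1"
    "metric (F q) (frechet_derivative F (at q) v2) (frechet_derivative F (at q) v2) = 1"
    "metric (F q) (frechet_derivative F (at q) v1) (frechet_derivative F (at q) v2) = 0"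
    "\<And>i j. matrix_inv (first_form F q) $ i $ j = v1 $ i * v1 $ j + v2 $ i * v2 $ j"
    "\<And>N i. metric (F q) N (frechet_derivative F (at q) v1) = 0 \<Longrightarrow>
      metric (F q) N (frechet_derivative F (at q) v2) = 0 \<Longrightarrow> metric (F q) N (partial i F q) = 0"
proof -
  define D where "D = frechet_derivative F (at q)"
  have lin: "linear D" unfolding D_def using d by (rule linear_frechet_derivative)
  define b where "b = (\<lambda>v w. metric (F q) (D v) (D w))"
  have b_commute: "b v w = b w v" for v w by (simp add: b_def metric_commute)
  have lin_b: "linear (b v)" for v
    unfolding b_def using linear_compose[OF lin linear_metric] by (simp add: o_def)
  have b_right: "b v (r *\<^sub>R w - c *\<^sub>R w') = r * b v w - c * b v w'" for v w w' r c
    by (simp add: linear_diff[OF lin_b] linear_scale[OF lin_b])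
  have b_scale: "b v (r *\<^sub>R w) = r * b v w" "b (r *\<^sub>R w) v = r * b w v" for v w r
    using b_commute by (simp_all add: linear_scale[OF lin_b])
  have b_pos: "b v v > 0" if "v \<noteq> 0" for v
  proof -
    have "D v \<noteq> 0" using that injD[OF inj, of v 0] linear_0[OF lin] by (auto simp: D_def)
    then show ?thesis unfolding b_def by (rule metric_pos[OF p])
  qed
  define e :: "2 \<Rightarrow> real^2" where "e = (\<lambda>i. axis i 1)"
  have e0: "e 1 \<noteq> 0" by (simp add: e_def)
  define \<alpha> where "\<alpha> = 1 / sqrt (b (e 1) (e 1))"
  define v1 where "v1 = \<alpha> *\<^sub>R e 1"
  define c where "c = b v1 (e 2)"
  define w where "w = 1 *\<^sub>R e 2 - c *\<^sub>R v1"
  have "w $ 2 = 1" by (simp add: w_def v1_def e_def axis_def)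
  then have w0: "w \<noteq> 0" by auto
  define \<beta> where "\<beta> = 1 / sqrt (b w w)"
  define v2 where "v2 = \<beta> *\<^sub>R w"
  have \<alpha>: "\<alpha> > 0" "\<alpha> * (\<alpha> * b (e 1) (e 1)) = 1"
    using b_pos[OF e0] by (auto simp: \<alpha>_def field_simps)
  have \<beta>: "\<beta> > 0" "\<beta> * (\<beta> * b w w) = 1"
    using b_pos[OF w0] by (auto simp: \<beta>_def field_simps)
  have b11: "b v1 v1 = 1" using \<alpha> by (simp add: v1_def b_scale)
  have b22: "b v2 v2 = 1" using \<beta> by (simp add: v2_def b_scale)
  have "b v1 w = 0" unfolding w_def b_right b11 by (simp add: c_def)
  then have b12: "b v1 v2 = 0" by (simp add: v2_def b_scale)
  have first: "first_form F q $ i $ j = b (e i) (e j)" for i j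
    by (simp add: first_form_def b_def e_def D_def partial_def)
  have expand: "b v w' = (\<Sum>i\<in>UNIV. \<Sum>j\<in>UNIV. v $ i * b (e i) (e j) * w' $ j)" for v w'
  proof -
    have ex: "u = (\<Sum>i\<in>UNIV. (u $ i) *\<^sub>R e i)" for u
      using basis_expansion[of u] by (simp add: scalar_mult_eq_scaleR e_def)
    have 1: "b u w' = (\<Sum>j\<in>UNIV. w' $ j * b u (e j))" for u w'
      by (subst ex[of w']) (simp add: linear_sum[OF lin_b] linear_scale[OF lin_b])
    have 2: "b v (e j) = (\<Sum>i\<in>UNIV. v $ i * b (e i) (e j))" for j
      using 1[of "e j" v] by (simp add: b_commute[of v "e j"] b_commute[of "e j" "e _"])
    show ?thesis
      unfolding 1[of v w'] 2 by (simp add: sum_2 algebra_simps)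
  qed
  define V :: "real^2^2" where "V = (\<chi> i k. if k = 1 then v1 $ i else v2 $ i)"
  have "transpose V ** (first_form F q ** V) = mat 1"
    using b11 b22 b12 b12[unfolded b_commute[of v1 v2]]
    unfolding expand[of v1 v1] expand[of v1 v2] expand[of v2 v1] expand[of v2 v2]
    by (simp add: vec_eq_iff forall_2 matrix_matrix_mult_def transpose_def mat_def sum_2 first V_def
        algebra_simps)
  then have "(first_form F q ** V) ** transpose V = mat 1"
    using matrix_left_right_inverse by blast
  then have "first_form F q ** (V ** transpose V) = mat 1"
    by (simp add: matrix_mul_assoc)
  then have inv: "matrix_inv (first_form F q) = V ** transpose V"
    by (rule matrix_inv_eqI)
  show thesis
  proof (rule that[of v1 v2])
    show "matrix_inv (first_form F q) $ i $ j = v1 $ i * v1 $ j + v2 $ i * v2 $ j" for i j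
      by (simp add: inv matrix_matrix_mult_def transpose_def V_def sum_2)
    fix N i
    assume N: "metric (F q) N (frechet_derivative F (at q) v1) = 0"
      "metric (F q) N (frechet_derivative F (at q) v2) = 0"
    have lin_N: "linear (\<lambda>v. metric (F q) N (D v))"
      using linear_compose[OF lin linear_metric] by (simp add: o_def)
    have 1: "metric (F q) N (D (e 1)) = 0"
      using N(1) \<alpha>(1) linear_scale[OF lin_N, of \<alpha> "e 1"] by (simp add: v1_def flip: D_def)
    have "metric (F q) N (D w) = 0"
      using N(2) \<beta>(1) linear_scale[OF lin_N, of \<beta> w] by (simp add: v2_def flip: D_def)
    then have "metric (F q) N (D (e 2)) = 0"
      using N(1) linear_diff[OF lin_N, of "e 2" "c *\<^sub>R v1"] linear_scale[OF lin_N, of c v1]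
      by (simp add: w_def flip: D_def)
    with 1 have "\<forall>i. metric (F q) N (D (e i)) = 0" by (simp add: forall_2)
    then show "metric (F q) N (partial i F q) = 0" by (simp add: D_def e_def partial_def)
  qed (use b11 b22 b12 in \<open>simp_all add: b_def D_def\<close>)
qed

lemma christoffel_sum:
  "christoffel p (\<Sum>i\<in>(UNIV::2 set). x i *\<^sub>R P i) (\<Sum>i\<in>UNIV. x i *\<^sub>R P i)
    = (\<Sum>j\<in>UNIV. \<Sum>i\<in>UNIV. (x j * x i) *\<^sub>R christoffel p (P i) (P j))"
  by (simp add: sum_2 christoffel_def scaleR_conv_of_real prod_eq_iff add_divide_distrib algebra_simps)

lemma metric_normal_part:
  assumes "\<And>i. metric (F q) N (partial i F q) = 0"
  shows "metric (F q) N (normal_part F q w) = metric (F q) N w"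
  unfolding normal_part_def
  by (simp add: linear_diff[OF linear_metric] linear_sum[OF linear_metric]
      linear_scale[OF linear_metric] assms)

text \<open>
  The two curves are the images of the straight parameter lines through \<open>q\<close> in the directions of
  an orthonormal frame. The sum of their covariant accelerations is the \<open>g\<^sup>-\<^sup>1\<close>-trace of \<open>cov_deriv\<close>,
  which has the normal part \<open>2\<^bold>H\<close>, and the bound follows from the Cauchy-Schwarz inequality.
\<close>

lemma immersion_mean_curv_below_half:
  assumes U: "open U" "q \<in> U" and S: "F ` U \<subseteq> S" and p: "Im (fst (F q)) > 0"
    and C2: "C_k_on 2 U F" and inj: "inj (frechet_derivative F (at q))"
    and H: "sqrt (metric (F q) (mean_curv_param F q) (mean_curv_param F q)) < 1 / 2"
  shows "mean_curv_below_half S (F q)"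
proof -
  define D where "D = frechet_derivative F (at q)"
  have d: "F differentiable (at q)" using C2 U(2) by (simp add: eval_nat_numeral)
  obtain v1 v2 where on: "metric (F q) (D v1) (D v1) = 1" "metric (F q) (D v2) (D v2) = 1"
      "metric (F q) (D v1) (D v2) = 0"
    and g: "\<And>i j. matrix_inv (first_form F q) $ i $ j = v1 $ i * v1 $ j + v2 $ i * v2 $ j"
    and N: "\<And>N i. metric (F q) N (D v1) = 0 \<Longrightarrow> metric (F q) N (D v2) = 0 \<Longrightarrow>
      metric (F q) N (partial i F q) = 0"
    using orthonormal_parameter_frame[OF p d inj] unfolding D_def by metis
  have D: "D v = (\<Sum>i\<in>UNIV. (v $ i) *\<^sub>R partial i F q)" for v
    unfolding D_def by (rule frechet_derivative_partial[OF d])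
  define a where "a v = (\<Sum>j\<in>UNIV. \<Sum>i\<in>UNIV. (v $ j * v $ i) *\<^sub>R partial i (partial j F) q)" for v
  have jet: "jet2 (\<lambda>\<tau>. F (q + \<tau> *\<^sub>R v)) (D v) (a v)" for v
    unfolding D a_def by (rule jet2_along_line[OF C2 U])
  have inS: "\<forall>\<^sub>F \<tau> in nhds 0. F (q + \<tau> *\<^sub>R v) \<in> S" for v
  proof -
    have "isCont (\<lambda>\<tau>. q + \<tau> *\<^sub>R v) 0" by (intro continuous_intros)
    then have "\<forall>\<^sub>F \<tau> in nhds 0. q + \<tau> *\<^sub>R v \<in> U"
      using U tendsto_at_iff_tendsto_nhds[of "\<lambda>\<tau>. q + \<tau> *\<^sub>R v" 0]
      by (auto simp: isCont_def dest: topological_tendstoD)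
    then show ?thesis by eventually_elim (use S in blast)
  qed
  have cov: "a v + christoffel (F q) (D v) (D v)
      = (\<Sum>j\<in>UNIV. \<Sum>i\<in>UNIV. (v $ j * v $ i) *\<^sub>R cov_deriv F q i j)" for v
    unfolding a_def D christoffel_sum cov_deriv_def
    by (simp add: sum.distrib[symmetric] scaleR_add_right[symmetric])
  have bound: "\<bar>metric (F q) N (a v1 + christoffel (F q) (D v1) (D v1))
      + metric (F q) N (a v2 + christoffel (F q) (D v2) (D v2))\<bar> < sqrt (metric (F q) N N)"
    if "metric (F q) N (D v1) = 0" "metric (F q) N (D v2) = 0" "N \<noteq> 0" for N
  proof -
    note lin = linear_sum[OF linear_metric] linear_scale[OF linear_metric]
      linear_add[OF linear_metric]
    have "metric (F q) N (mean_curv_param F q)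
      = 1/2 * (\<Sum>i\<in>UNIV. \<Sum>j\<in>UNIV. matrix_inv (first_form F q) $ i $ j
          * metric (F q) N (cov_deriv F q i j))"
      unfolding mean_curv_param_def second_form_def
      by (simp add: lin metric_normal_part[of F q N, OF N[OF that(1,2)]])
    then have "metric (F q) N (a v1 + christoffel (F q) (D v1) (D v1))
      + metric (F q) N (a v2 + christoffel (F q) (D v2) (D v2))
      = 2 * metric (F q) N (mean_curv_param F q)"
      unfolding cov by (simp add: lin g sum_2 algebra_simps)
    also have "\<bar>\<dots>\<bar> \<le> 2 * (sqrt (metric (F q) N N)
        * sqrt (metric (F q) (mean_curv_param F q) (mean_curv_param F q)))"
      using metric_Cauchy_Schwarz[of "F q" N "mean_curv_param F q"] by simp
    also have "\<dots> < sqrt (metric (F q) N N)"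
      using mult_strict_left_mono[OF H, of "sqrt (metric (F q) N N)"] metric_pos[OF p that(3)]
      by simp
    finally show ?thesis .
  qed
  show ?thesis
    unfolding mean_curv_below_half_def
    using jet[of v1] jet[of v2] inS[of v1] inS[of v2] on bound
    by (intro exI[of _ "\<lambda>\<tau>. F (q + \<tau> *\<^sub>R v1)"] exI[of _ "D v1"] exI[of _ "a v1"]
        exI[of _ "\<lambda>\<tau>. F (q + \<tau> *\<^sub>R v2)"] exI[of _ "D v2"] exI[of _ "a v2"]) simp
qed

section \<open>Surfaces in horocylinders\<close>

lemma properly_immersed_mean_curv_below_half:
  assumes X: "properly_immersed_surface M \<A> X" and p: "p \<in> topspace M"
    and H: "mean_curv_norm \<A> X p < 1 / 2"
  shows "mean_curv_below_half (X ` topspace M) (X p)"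
proof -
  have atlas: "\<forall>c\<in>\<A>. is_chart M c" "(\<Union>c\<in>\<A>. fst c) = topspace M"
    and imm: "immersion M \<A> X"
    using X by (auto simp: properly_immersed_surface_def smooth_surface_def)
  define c where "c = (SOME c. c \<in> \<A> \<and> p \<in> fst c)"
  have "\<exists>c. c \<in> \<A> \<and> p \<in> fst c" using atlas(2) p by blast
  then have c: "c \<in> \<A>" "p \<in> fst c" unfolding c_def by (metis (mono_tags, lifting) someI_ex)+
  have sub: "fst c \<subseteq> topspace M" using atlas(2) c(1) by blast
  have "inj_on (snd c) (fst c)"
    using atlas(1) c(1) sub homeomorphic_imp_injective_map
    by (fastforce simp: is_chart_def Int_absorb1)
  then have inv: "chart_inv c (snd c p) = p"
    unfolding chart_inv_def using c(2) by (rule inv_into_f_f)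
  define F where "F = X \<circ> chart_inv c"
  define q where "q = snd c p"
  have Fq: "F q = X p" by (simp add: F_def q_def inv)
  have q: "q \<in> chart_image c" using c(2) by (simp add: q_def chart_image_def)
  have "mean_curv_below_half (X ` topspace M) (F q)"
  proof (rule immersion_mean_curv_below_half)
    show "open (chart_image c)" using atlas(1) c(1) by (simp add: is_chart_def)
    show "q \<in> chart_image c" by (rule q)
    show "F ` chart_image c \<subseteq> X ` topspace M"
      using sub inv_into_into[of _ "snd c" "fst c"]
      by (fastforce simp: F_def chart_inv_def chart_image_def)
    show "0 < Im (fst (F q))"
      using imm p by (auto simp: Fq immersion_def H2xR_def H2_def)
    show "C_k_on 2 (chart_image c) F"
      using imm c(1) by (auto simp: immersion_def smooth_on_def F_def)
    show "inj (frechet_derivative F (at q))"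
      using imm c(1) q by (auto simp: immersion_def F_def)
    show "sqrt (metric (F q) (mean_curv_param F q) (mean_curv_param F q)) < 1 / 2"
      using H unfolding mean_curv_norm_def mean_curv_def c_def[symmetric] Let_def Fq
      by (simp add: F_def q_def)
  qed
  then show ?thesis by (simp add: Fq)
qed

text \<open>
  The boundary at infinity \<open>Im z = 0\<close> is kept away.
\<close>

lemma closed_of_closedin_H2xR:
  assumes S: "closedin (top_of_set H2xR) S" and c: "c > 0" "\<And>p. p \<in> S \<Longrightarrow> c \<le> Im (fst p)"
  shows "closed S"
proof -
  obtain T where T: "closed T" "S = H2xR \<inter> T" using S by (auto simp: closedin_closed)
  have "S = T \<inter> {p. c \<le> Im (fst p)}"
    using T(2) c by (force simp: H2xR_def H2_def)
  moreover have "closed {p::complex \<times> real. c \<le> Im (fst p)}"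
    by (intro closed_Collect_le continuous_intros)
  ultimately show ?thesis using T(1) by auto
qed

lemma closedin_inversion:
  assumes S: "closedin (top_of_set H2xR) S"
  shows "closedin (top_of_set H2xR) (inversion a ` S)"
proof -
  define \<psi> :: "complex \<times> real \<Rightarrow> complex \<times> real" where
    "\<psi> = (\<lambda>p. (of_real a - inverse (fst p), snd p))"
  have nz: "z \<noteq> 0" if "0 < Im z" for z using that by auto
  have inv1: "\<psi> (inversion a p) = p" for p
    by (simp add: \<psi>_def inversion_def)
  have inv2: "inversion a (\<psi> p) = p" for p
    by (simp add: \<psi>_def inversion_def)
  have \<psi>: "\<psi> p \<in> H2xR" if "p \<in> H2xR" for p
    using that nz[of "fst p"] by (auto simp: \<psi>_def H2xR_def H2_def divide_neg_pos sum_power2_gt_zero_iff)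
  have \<phi>: "inversion a p \<in> H2xR" if "p \<in> H2xR" for p
    using that nz[of "fst p - of_real a"]
    by (auto simp: H2xR_def H2_def mem_Times_iff Im_inversion)
  have "continuous_on H2xR \<psi>"
    unfolding \<psi>_def using nz by (intro continuous_intros) (auto simp: H2xR_def H2_def)
  then have "closedin (top_of_set H2xR) (H2xR \<inter> \<psi> -` S)"
    using \<psi> S by (intro continuous_closedin_preimage_gen) auto
  moreover have "H2xR \<inter> \<psi> -` S = inversion a ` S"
  proof
    show "H2xR \<inter> \<psi> -` S \<subseteq> inversion a ` S" using inv2 by (metis IntE image_eqI subsetI vimageE)
    show "inversion a ` S \<subseteq> H2xR \<inter> \<psi> -` S"
      using closedin_subset[OF S] \<phi> inv1 by auto
  qed
  ultimately show ?thesis by simp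
qed

text \<open>
  By an inversion when necessary, the horoball may be taken to be a half-plane \<open>Im z > c\<close>.
\<close>

theorem no_surface_in_horocylinder:
  assumes S: "closedin (top_of_set H2xR) S" and B: "horoball B"
    and SB: "S \<subseteq> (top_of_set H2 closure_of B) \<times> UNIV"
    and H: "\<And>p. p \<in> S \<Longrightarrow> mean_curv_below_half S p"
  shows "S = {}"
proof -
  have Im0: "0 < Im (fst p)" if "p \<in> S" for p
    using closedin_subset[OF S] that by (auto simp: H2xR_def H2_def)
  have sub: "top_of_set H2 closure_of B \<subseteq> closure B"
    using closure_of_subtopology_subset[of euclidean H2 B] by simp
  then have SB': "fst p \<in> closure B" if "p \<in> S" for p
    using subsetD[OF SB that] subsetD[OF sub] by (simp add: mem_Times_iff)
  from B consider c where "c > 0" "B = {z. Im z > c}"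
    | a r where "r > 0" "B = ball (Complex a r) r"
    unfolding horoball_def by blast
  then show ?thesis
  proof cases
    case 1
    have "closure B \<subseteq> {z. c \<le> Im z}"
      unfolding 1 by (intro closure_minimal closed_Collect_le continuous_intros) auto
    then have c: "c \<le> Im (fst p)" if "p \<in> S" for p using SB'[OF that] by auto
    show ?thesis
      using no_surface_above_horocycle[OF closed_of_closedin_H2xR[OF S 1(1) c] 1(1) c H] .
  next
    case 2
    have cl: "closure B = cball (Complex a r) r" using 2 by (simp add: closure_ball)
    have c: "1 / (2 * r) \<le> Im (fst (inversion a p))" if "p \<in> S" for p
    proof -
      define z where "z = fst p - of_real a"
      \<comment> \<open>With \<open>a\<close> moved to the origin, the closed disc is \<open>|z|\<^sup>2 \<le> 2 r y\<close>, that is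
        \<open>Im (- 1 / z) = y / |z|\<^sup>2 \<ge> 1 / (2 r)\<close>.\<close>
      have "cmod (z - Complex 0 r) \<le> r"
        using SB'[OF that] by (simp add: cl z_def dist_commute dist_norm Complex_eq algebra_simps)
      then have "(cmod (z - Complex 0 r))\<^sup>2 \<le> r\<^sup>2" by (intro power_mono) auto
      then have le: "(cmod z)\<^sup>2 \<le> 2 * r * Im z"
        by (simp add: cmod_power2) (simp add: power2_diff algebra_simps)
      have y: "Im z = Im (fst p)" "0 < Im z" using Im0[OF that] by (auto simp: z_def)
      then have "0 < (cmod z)\<^sup>2" by auto
      then have "1 / (2 * r) \<le> Im z / (cmod z)\<^sup>2"
        using le 2(1) by (simp add: field_simps)
      then show ?thesis by (simp add: Im_inversion z_def)
    qed
    then have c': "1 / (2 * r) \<le> Im (fst p)" if "p \<in> inversion a ` S" for p using that by auto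
    have r: "0 < 1 / (2 * r)" using 2(1) by simp
    have "inversion a ` S = {}"
    proof (rule no_surface_above_horocycle[OF _ r c'])
      show "closed (inversion a ` S)"
        by (rule closed_of_closedin_H2xR[OF closedin_inversion[OF S] r c'])
      show "mean_curv_below_half (inversion a ` S) p" if "p \<in> inversion a ` S" for p
        using that mean_curv_below_half_inversion H Im0 by blast
    qed
    then show ?thesis by simp
  qed
qed

theorem theorem9:
  fixes M :: "'a topology" and \<A> :: "'a chart set" and X :: "'a \<Rightarrow> complex \<times> real"
    and B :: "complex set"
  assumes "properly_immersed_surface M \<A> X"
    and "horoball B"
    and "X ` topspace M \<subseteq> (top_of_set H2 closure_of B) \<times> UNIV"
  shows "((\<exists>p\<in>topspace M. X p \<in> B \<times> UNIV) \<longrightarrow>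
            (SUP p\<in>topspace M. ereal (mean_curv_norm \<A> X p)) \<ge> 1/2) \<and>
         ((\<forall>p\<in>topspace M. mean_curv_norm \<A> X p < 1/2) \<longrightarrow>
            X ` topspace M \<subseteq> (top_of_set H2 frontier_of B) \<times> UNIV)"
proof -
  have "closed_map M (top_of_set H2xR) X"
    using assms(1) by (auto simp: properly_immersed_surface_def proper_map_def)
  then have closed: "closedin (top_of_set H2xR) (X ` topspace M)"
    by (auto simp: closed_map_def)
  have empty: "topspace M = {}" if H: "\<forall>p\<in>topspace M. mean_curv_norm \<A> X p < 1/2"
  proof -
    have "mean_curv_below_half (X ` topspace M) s" if "s \<in> X ` topspace M" for s
      using that H properly_immersed_mean_curv_below_half[OF assms(1)] by blast
    then have "X ` topspace M = {}"
      by (rule no_surface_in_horocylinder[OF closed assms(2,3)])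
    then show ?thesis by simp
  qed
  have "(SUP p\<in>topspace M. ereal (mean_curv_norm \<A> X p)) \<ge> 1/2" if p: "p \<in> topspace M" for p
  proof (rule ccontr)
    assume "\<not> ?thesis"
    moreover have "(1/2::ereal) = ereal (1/2)"
      by (simp add: one_ereal_def numeral_eq_ereal)
    ultimately have less: "(SUP p\<in>topspace M. ereal (mean_curv_norm \<A> X p)) < ereal (1/2)"
      by (simp only: not_le)
    have "ereal (mean_curv_norm \<A> X p) < ereal (1/2)" if "p \<in> topspace M" for p
      by (rule le_less_trans[OF SUP_upper[OF that] less])
    then have "\<forall>p\<in>topspace M. mean_curv_norm \<A> X p < 1/2" by simp
    then show False using empty p by blast
  qed
  with empty show ?thesis by blast
qed

end
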